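(* Let $\tilde g\in\mathcal S(\mathbb R_+)$ be a normalized incoming test function. For both the relativistic black-hole model, $x(y)=-e^{-y}$, and the CGHS black-hole model, $x(y)=-\log(1+e^{-y})$, $$\lim_{y\to+\infty}\widehat T_g(y)=T^{Th}_{2\pi,out}.$$ Furthermore, for the CGHS model, $$\lim_{y\to-\infty}\widehat T_g(y)=T^{Th}_{\infty,out}.$$ Here $T^{Th}_{\beta,out}=\frac{\pi}{12\beta^2}$, so that $T^{Th}_{2\pi,out}=\frac1{48\pi}$ and $T^{Th}_{\infty,out}=0$.
   Context: Fourier transform: $\tilde f(p)=\frac1{\sqrt{2\pi}}\int f(y)e^{-ipy}\,dy$. "$\tilde g\in\mathcal S(\mathbb R_+)$" means that $g$ is Schwartz with $\tilde g(k)=0$ for $k\le0$; normalized means $\int_0^\infty\frac{dk}{2k}|\tilde g(k)|^2=1$. Real massless right-moving field: $\phi(x)=\frac1{\sqrt{2\pi}}\int_0^\infty\frac{dk}{2k}[a_{in}(k)e^{-ikx}+a_{in}^\dagger(k)e^{ikx}]$, $[a_{in}(k),a_{in}^\dagger(k')]=2k\,\delta(k-k')$, incoming vacuum $\Omega_o$ with $a_{in}(k)\Omega_o=0$, $\phi[h]=\int h\phi\,dx$, one-particle state $\Omega_g=\phi[g]^\dagger\Omega_o$. Outgoing field $\hat\phi(y)=\phi(x(y))$, $y\in\mathbb R$. The outgoing regularized energy-momentum tensor in the state $\Omega_g$ is $$\widehat T_g(y)=\lim_{\varepsilon\to0}\big[(\Omega_g,\widehat\Theta_\varepsilon(y)\Omega_g)-(\Omega_o,\Theta_\varepsilon(x(y))\Omega_o)\big],$$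 with $\Theta_\varepsilon(x)=\frac12[\partial_x\phi(x)^\dagger\partial_x\phi(x+\varepsilon)+\partial_x\phi(x+\varepsilon)^\dagger\partial_x\phi(x)]$ and $\widehat\Theta_\varepsilon(y)=\frac12[\partial_y\hat\phi(y)^\dagger\partial_y\hat\phi(y+\varepsilon)+\partial_y\hat\phi(y+\varepsilon)^\dagger\partial_y\hat\phi(y)]$ (equivalently, it is the mean value of $\partial_y\hat\phi(y)^\dagger\partial_y\hat\phi(y)$ normal ordered with respect to the outgoing creation and annihilation operators). *)

theory Defs
  imports "HOL-Analysis.Analysis" "HOL-Library.Multiset"
begin

definition vderiv :: "(real \<Rightarrow> complex) \<Rightarrow> real \<Rightarrow> complex" where
  "vderiv f = (\<lambda>x. vector_derivative f (at x))"

definition smooth :: "(real \<Rightarrow> complex) \<Rightarrow> bool" where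
  "smooth f \<longleftrightarrow> (\<forall>n x. (vderiv ^^ n) f differentiable (at x))"

definition schwartz :: "(real \<Rightarrow> complex) \<Rightarrow> bool" where
  "schwartz f \<longleftrightarrow> smooth f \<and>
     (\<forall>m n. bounded (range (\<lambda>x. x ^ m *\<^sub>R (vderiv ^^ n) f x)))"

definition supp :: "(real \<Rightarrow> complex) \<Rightarrow> real set" where
  "supp f = closure {x. f x \<noteq> 0}"

definition test_fun :: "(real \<Rightarrow> complex) \<Rightarrow> bool" where
  "test_fun f \<longleftrightarrow> smooth f \<and> compact (supp f)"

definition fourier :: "(real \<Rightarrow> complex) \<Rightarrow> real \<Rightarrow> complex" where
  "fourier f p = complex_of_real (1 / sqrt (2 * pi)) * (\<integral>y. f y * exp (- \<i> * of_real (p * y)) \<partial>lborel)"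

definition dk2k :: "real measure" where
  "dk2k = density lborel (\<lambda>k. ennreal (indicator {0<..} k / (2 * k)))"

text \<open>Following the convention for \<open>S(R_+)\<close>, the argument here is \<open>g\<close> itself, not its transform.\<close>

definition schwartz_plus :: "(real \<Rightarrow> complex) \<Rightarrow> bool" where
  "schwartz_plus g \<longleftrightarrow> schwartz g \<and> (\<forall>k\<le>0. fourier g k = 0)"

definition normalized :: "(real \<Rightarrow> complex) \<Rightarrow> bool" where
  "normalized g \<longleftrightarrow> (\<integral>k. (cmod (fourier g k))\<^sup>2 \<partial>dk2k) = 1"

text \<open>
  Bosonic Fock space over \<open>L\<^sup>2(dk/2k)\<close>: a state is represented by its momentum wave
  functions; the \<open>n\<close>-particle component is the restriction to multisets of size \<open>n\<close>, so Bose symmetry is built into the type. Square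
  integrability is not part of the type, and states are not identified almost everywhere.
\<close>

type_synonym fock = "real multiset \<Rightarrow> complex"

definition fock_inner :: "fock \<Rightarrow> fock \<Rightarrow> complex" where
  "fock_inner \<Psi> \<Phi> = (\<Sum>n. \<integral>\<omega>.
      cnj (\<Psi> (image_mset \<omega> (mset_set {..<n}))) * \<Phi> (image_mset \<omega> (mset_set {..<n}))
      \<partial>(PiM {..<n} (\<lambda>_. dk2k)))"

definition vacuum :: fock where
  "vacuum M = (if M = {#} then 1 else 0)"

text \<open>
  \<open>annihilate F\<close> is \<open>\<integral> dk/(2k) F(k) a(k)\<close> and \<open>create G\<close> is \<open>\<integral> dk/(2k) G(k) a\<^sup>\<dagger>(k)\<close>; both are
  linear in the smearing function, and \<open>annihilate F\<close> is formally adjoint to \<open>create (cnj \<circ> F)\<close>.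
  The relation \<open>[a(k), a\<^sup>\<dagger>(k')] = 2k \<delta>(k - k')\<close> takes the smeared form \<open>ccr\<close> below.
\<close>

definition annihilate :: "(real \<Rightarrow> complex) \<Rightarrow> fock \<Rightarrow> fock" where
  "annihilate F \<Psi> M =
     complex_of_real (sqrt (real (size M + 1))) * (\<integral>k. F k * \<Psi> (add_mset k M) \<partial>dk2k)"

definition create :: "(real \<Rightarrow> complex) \<Rightarrow> fock \<Rightarrow> fock" where
  "create G \<Psi> M =
     complex_of_real (1 / sqrt (real (size M))) * (\<Sum>k\<in>#M. G k * \<Psi> (M - {#k#}))"

lemma annihilate_vacuum: "annihilate F vacuum = (\<lambda>_. 0)"
  by (simp add: annihilate_def vacuum_def fun_eq_iff)

lemma ccr:
  assumes FG: "integrable dk2k (\<lambda>k. F k * G k)"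
    and F\<Psi>: "\<And>N. integrable dk2k (\<lambda>k. F k * \<Psi> (add_mset k N))"
  shows "annihilate F (create G \<Psi>) M - create G (annihilate F \<Psi>) M
           = (\<integral>k. F k * G k \<partial>dk2k) * \<Psi> M"
proof -
  let ?R = "\<Sum>l\<in>#M. G l * (\<integral>k. F k * \<Psi> (add_mset k (M - {#l#})) \<partial>dk2k)"
  have int: "integrable dk2k (\<lambda>k. \<Sum>l\<in>#A. G l * (F k * \<Psi> (add_mset k (M - {#l#}))))
     \<and> (\<integral>k. (\<Sum>l\<in>#A. G l * (F k * \<Psi> (add_mset k (M - {#l#})))) \<partial>dk2k)
       = (\<Sum>l\<in>#A. G l * (\<integral>k. F k * \<Psi> (add_mset k (M - {#l#})) \<partial>dk2k))" for A
    by (induction A) (auto simp: F\<Psi>)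
  have eq: "F k * create G \<Psi> (add_mset k M) = complex_of_real (1 / sqrt (real (size M + 1))) *
      (F k * G k * \<Psi> M + (\<Sum>l\<in>#M. G l * (F k * \<Psi> (add_mset k (M - {#l#})))))" for k
  proof -
    have "(\<Sum>l\<in>#M. G l * \<Psi> (add_mset k M - {#l#})) = (\<Sum>l\<in>#M. G l * \<Psi> (add_mset k (M - {#l#})))"
      by (intro arg_cong[where f=sum_mset] image_mset_cong) (metis insert_DiffM add_mset_remove_trivial_eq diff_union_swap2)
    then show ?thesis
      by (simp add: create_def sum_mset_distrib_left algebra_simps)
  qed
  have 1: "annihilate F (create G \<Psi>) M = (\<integral>k. F k * G k \<partial>dk2k) * \<Psi> M + ?R"
    using int[of M] FG by (simp add: annihilate_def eq)
  have "(\<Sum>l\<in>#M. G l * annihilate F \<Psi> (M - {#l#})) = complex_of_real (sqrt (real (size M))) * ?R"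
  proof -
    have "image_mset (\<lambda>l. G l * annihilate F \<Psi> (M - {#l#})) M
        = image_mset (\<lambda>l. complex_of_real (sqrt (real (size M))) * (G l * (\<integral>k. F k * \<Psi> (add_mset k (M - {#l#})) \<partial>dk2k))) M"
    proof (rule image_mset_cong)
      fix l assume "l \<in># M"
      then have "size M = size (M - {#l#}) + 1" by (metis insert_DiffM size_add_mset Suc_eq_plus1)
      then show "G l * annihilate F \<Psi> (M - {#l#}) = complex_of_real (sqrt (real (size M))) * (G l * (\<integral>k. F k * \<Psi> (add_mset k (M - {#l#})) \<partial>dk2k))"
        by (simp add: annihilate_def)
    qed
    then show ?thesis by (simp add: sum_mset_distrib_left)
  qed
  then have 2: "create G (annihilate F \<Psi>) M = ?R"
    by (cases "M = {#}") (simp_all add: create_def)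
  from 1 2 show ?thesis by simp
qed

text \<open>
  \<open>mode X h k\<close> is the coefficient of \<open>a(k)\<close> in \<open>\<integral> h(y) \<phi>(X(y)) dy\<close>; that of \<open>a\<^sup>\<dagger>(k)\<close> is
  \<open>mode X h (- k)\<close>. Hence \<open>smeared_field X h\<close> is the smeared field \<open>\<integral> h(y) \<phi>(X(y)) dy\<close>: the incoming
  field \<open>\<phi>[h]\<close> for \<open>X(x) = x\<close>, the outgoing one for the outgoing-to-incoming map \<open>X = x(y)\<close>.
\<close>

definition mode :: "(real \<Rightarrow> real) \<Rightarrow> (real \<Rightarrow> complex) \<Rightarrow> real \<Rightarrow> complex" where
  "mode X h k = complex_of_real (1 / sqrt (2 * pi)) * (\<integral>y. h y * exp (- \<i> * of_real (k * X y)) \<partial>lborel)"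

definition smeared_field :: "(real \<Rightarrow> real) \<Rightarrow> (real \<Rightarrow> complex) \<Rightarrow> fock \<Rightarrow> fock" where
  "smeared_field X h \<Psi> M = annihilate (mode X h) \<Psi> M + create (\<lambda>k. mode X h (- k)) \<Psi> M"

definition smeared_field_adjoint :: "(real \<Rightarrow> real) \<Rightarrow> (real \<Rightarrow> complex) \<Rightarrow> fock \<Rightarrow> fock" where
  "smeared_field_adjoint X h \<Psi> M =
     create (\<lambda>k. cnj (mode X h k)) \<Psi> M + annihilate (\<lambda>k. cnj (mode X h (- k))) \<Psi> M"

text \<open>The distributional derivative \<open>\<partial>\<^sub>y\<phi>(X(y))\<close> smeared with \<open>h\<close>.\<close>

definition dfield :: "(real \<Rightarrow> real) \<Rightarrow> (real \<Rightarrow> complex) \<Rightarrow> fock \<Rightarrow> fock" where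
  "dfield X h \<Psi> M = - smeared_field X (vderiv h) \<Psi> M"

lemma mode_id: "mode (\<lambda>x. x) = fourier"
  by (simp add: fun_eq_iff mode_def fourier_def)

lemma mode_cnj: "mode X (\<lambda>y. cnj (h y)) k = cnj (mode X h (- k))"
proof -
  have "cnj (\<integral>y. h y * exp (- \<i> * of_real (- k * X y)) \<partial>lborel) = (\<integral>y. cnj (h y * exp (- \<i> * of_real (- k * X y))) \<partial>lborel)"
    by (rule Bochner_Integration.integral_cnj[symmetric])
  also have "\<dots> = (\<integral>y. cnj (h y) * exp (- \<i> * of_real (k * X y)) \<partial>lborel)"
    by (simp add: exp_cnj)
  finally show ?thesis by (simp add: mode_def)
qed

lemma smeared_field_adjoint_eq: "smeared_field_adjoint X h = smeared_field X (\<lambda>y. cnj (h y))"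
proof -
  have "mode X (\<lambda>y. cnj (h y)) = (\<lambda>k. cnj (mode X h (- k)))"
    by (intro ext) (rule mode_cnj)
  then show ?thesis
    by (intro ext) (simp add: smeared_field_adjoint_def smeared_field_def add.commute)
qed

definition one_particle :: "(real \<Rightarrow> complex) \<Rightarrow> fock" where
  "one_particle g = smeared_field_adjoint (\<lambda>x. x) g vacuum"

text \<open>
  Off the diagonal, \<open>(\<Psi>, \<partial>\<phi>(X(y))\<^sup>\<dagger> \<partial>\<phi>(X(y')) \<Psi>)\<close> is the value at \<open>(y, y')\<close> of the continuous
  function representing the bidistribution \<open>(f, h) \<mapsto> (\<partial>\<phi>[f] \<Psi>, \<partial>\<phi>[h] \<Psi>)\<close> there. Such a function
  is unique, being determined by test functions with disjoint supports.
\<close>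

definition is_correlator ::
    "(real \<Rightarrow> real) \<Rightarrow> fock \<Rightarrow> (real \<Rightarrow> real \<Rightarrow> complex) \<Rightarrow> bool" where
  "is_correlator X \<Psi> w \<longleftrightarrow>
     continuous_on {(y, y'). y \<noteq> y'} (\<lambda>(y, y'). w y y') \<and>
     (\<forall>f h. test_fun f \<and> test_fun h \<and> supp f \<inter> supp h = {} \<longrightarrow>
        fock_inner (dfield X f \<Psi>) (dfield X h \<Psi>)
          = (\<integral>y. (\<integral>y'. cnj (f y) * h y' * w y y' \<partial>lborel) \<partial>lborel))"

definition correlator :: "(real \<Rightarrow> real) \<Rightarrow> fock \<Rightarrow> real \<Rightarrow> real \<Rightarrow> complex" where
  "correlator X \<Psi> y y' = (THE c. \<exists>w. is_correlator X \<Psi> w \<and> c = w y y')"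

definition theta_mean :: "(real \<Rightarrow> real) \<Rightarrow> fock \<Rightarrow> real \<Rightarrow> real \<Rightarrow> complex" where
  "theta_mean X \<Psi> \<epsilon> y = (correlator X \<Psi> y (y + \<epsilon>) + correlator X \<Psi> (y + \<epsilon>) y) / 2"

definition emt_out :: "(real \<Rightarrow> real) \<Rightarrow> (real \<Rightarrow> complex) \<Rightarrow> real \<Rightarrow> complex" where
  "emt_out X g y = Lim (at 0)
     (\<lambda>\<epsilon>. theta_mean X (one_particle g) \<epsilon> y - theta_mean (\<lambda>x. x) vacuum \<epsilon> (X y))"

definition x_rel :: "real \<Rightarrow> real" where
  "x_rel y = - exp (- y)"

definition x_CGHS :: "real \<Rightarrow> real" where
  "x_CGHS y = - ln (1 + exp (- y))"

definition emt_thermal :: "ereal \<Rightarrow> real" where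
  "emt_thermal \<beta> = real_of_ereal (ereal pi / (12 * \<beta>\<^sup>2))"

end

(*
  Write D for the Fourier transform of the Fourier transform of g, so that D(-x) is g(x) up to
  Fourier inversion, which is never needed.  Away from the diagonal the correlator of the field
  reparametrized by X in the state of g is
    - X'(y) X'(z) / (4 pi (X(y) - X(z))^2)
    + X'(y) X'(z) Re (D(-X(y)) cnj D(-X(z))) / 2.
  The first term is the vacuum part: damping the k-integral by exp (- L k), using
  "integral of k exp (- z k) over k > 0 = 1 / z^2", and letting L tend to 0, which is harmless
  because the test functions have disjoint supports.  Subtracting the incoming vacuum value
  - 1 / (4 pi eps^2) and letting eps tend to 0 leaves
    - S(y) / (24 pi) + X'(y)^2 |D(-X(y))|^2 / 2,   S the Schwarzian derivative of X.
  For y -> oo both maps have S -> - 1/2 and X' -> 0, and D is bounded.  For y -> -oo the CGHS map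
  has S -> 0 and X' -> 1, and D(-X(y)) -> 0 by Riemann-Lebesgue.
*)

theory Submission
  imports Defs "HOL-Probability.Probability" "HOL-Real_Asymp.Real_Asymp"
begin

section \<open>The measure dk/2k and matrix elements in Fock space\<close>

text \<open>The correlator is a definite description, so nothing can be computed before a suitable
  continuous function is exhibited and shown unique off the diagonal; bump functions are built for
  the latter. After that only ordinary functions of two points are left. The weight
  \<open>dk/2k\<close> is singular at 0. The derivative field involves only modes of
  \<open>vderiv h\<close>, so one integration by parts supplies a factor \<open>k\<close>; a second
  one, after dividing by \<open>X'\<close>, supplies decay at large momentum. The joint integral
  over momentum and positions is still not absolutely convergent, hence the damping. The field takes
  a one-particle state to zero or two particles. On two particles the packet is either a spectator,
  whose norm 1 reproduces the vacuum correlator, or is exchanged with the created particle; the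
  exchange term and the zero-particle term together give the real part in the packet contribution.
  The thermal value arises from \<open>1 / (4 * sinh (\<epsilon> / 2)^2) = 1 / \<epsilon>^2 - 1 / 12
  + ...\<close>, as \<open>1 / 12\<close> divided by \<open>4 * pi\<close> is
  \<open>1 / (48 * pi)\<close>.\<close>

lemma sets_dk2k [measurable_cong, simp]: "sets dk2k = sets borel"
  by (simp add: dk2k_def)

lemma space_dk2k [simp]: "space dk2k = UNIV"
  by (simp add: dk2k_def)

lemma integrable_dk2k_iff:
  fixes F :: "real \<Rightarrow> 'a::{banach, second_countable_topology}"
  assumes "F \<in> borel_measurable borel"
  shows "integrable dk2k F \<longleftrightarrow> integrable lborel (\<lambda>k. (indicator {0<..} k / (2 * k)) *\<^sub>R F k)"
  unfolding dk2k_def by (rule integrable_density) (use assms in \<open>auto simp: indicator_def\<close>)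

lemma integral_dk2k_eq:
  fixes F :: "real \<Rightarrow> 'a::{banach, second_countable_topology}"
  assumes "F \<in> borel_measurable borel"
  shows "integral\<^sup>L dk2k F = (\<integral>k. (indicator {0<..} k / (2 * k)) *\<^sub>R F k \<partial>lborel)"
  unfolding dk2k_def by (rule integral_density) (use assms in \<open>auto simp: indicator_def\<close>)

lemma sigma_finite_dk2k: "sigma_finite_measure dk2k"
  unfolding dk2k_def
  by (subst sigma_finite_measure.sigma_finite_iff_density_finite[OF sigma_finite_lborel]) auto

interpretation dk2k_prod: product_sigma_finite "\<lambda>_::nat. dk2k"
  by (simp add: product_sigma_finite_def sigma_finite_dk2k)

lemma mset_set_lessThan_small:
  "mset_set {..<0::nat} = {#}" "mset_set {..<Suc 0} = {#0#}" "mset_set {..<2::nat} = {#0, 1#}"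
proof -
  show "mset_set {..<2::nat} = {#0, 1#}"
    by (simp add: numeral_2_eq_2 lessThan_Suc add_mset_commute)
qed (simp_all add: lessThan_Suc)

text \<open>The product of no factors is a one-point space of mass 1; the product formula for an
  empty product shows this at the level of integrals.\<close>

lemma integral_PiM_0:
  "(\<integral>\<omega>. (c::complex) \<partial>(PiM {..<0::nat} (\<lambda>_. dk2k))) = c"
proof -
  have "(\<integral>\<omega>. c \<partial>(PiM {..<0::nat} (\<lambda>_. dk2k))) = c * (\<integral>\<omega>. (\<Prod>i\<in>{..<0::nat}. (\<lambda>_ _. 1::complex) i (\<omega> i)) \<partial>(PiM {..<0::nat} (\<lambda>_. dk2k)))"
    by (simp only: integral_mult_right_zero[symmetric]) simp
  also have "\<dots> = c"
    by (subst dk2k_prod.product_integral_prod) auto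
  finally show ?thesis .
qed

lemma integral_PiM_1:
  fixes u :: "real \<Rightarrow> complex"
  assumes "integrable dk2k u"
  shows "(\<integral>\<omega>. u (\<omega> 0) \<partial>(PiM {..<Suc 0} (\<lambda>_. dk2k))) = integral\<^sup>L dk2k u"
proof -
  have "(\<integral>\<omega>. (\<Prod>i\<in>{..<Suc 0}. (\<lambda>_. u) i (\<omega> i)) \<partial>(PiM {..<Suc 0} (\<lambda>_. dk2k))) = integral\<^sup>L dk2k u"
    by (subst dk2k_prod.product_integral_prod) (auto simp: assms)
  then show ?thesis by simp
qed

lemma integral_PiM_2:
  fixes u v :: "real \<Rightarrow> complex"
  assumes "integrable dk2k u" "integrable dk2k v"
  shows "integrable (PiM {..<2::nat} (\<lambda>_. dk2k)) (\<lambda>\<omega>. u (\<omega> 0) * v (\<omega> 1))"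
    and "(\<integral>\<omega>. u (\<omega> 0) * v (\<omega> 1) \<partial>(PiM {..<2::nat} (\<lambda>_. dk2k))) = integral\<^sup>L dk2k u * integral\<^sup>L dk2k v"
proof -
  define w where "w i = (if i = (0::nat) then u else v)" for i
  have w: "integrable dk2k (w i)" for i by (simp add: w_def assms)
  have eq: "(\<Prod>i<2. w i (\<omega> i)) = u (\<omega> 0) * v (\<omega> 1)" for \<omega>
    by (simp add: w_def numeral_2_eq_2)
  show "integrable (PiM {..<2::nat} (\<lambda>_. dk2k)) (\<lambda>\<omega>. u (\<omega> 0) * v (\<omega> 1))"
    using dk2k_prod.product_integrable_prod[of "{..<2}" w] w by (simp add: eq)
  show "(\<integral>\<omega>. u (\<omega> 0) * v (\<omega> 1) \<partial>(PiM {..<2::nat} (\<lambda>_. dk2k))) = integral\<^sup>L dk2k u * integral\<^sup>L dk2k v"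
    using dk2k_prod.product_integral_prod[of "{..<2}" w] w
    by (simp add: eq) (simp add: w_def numeral_2_eq_2)
qed

section \<open>The derivative field on the vacuum and on a one-particle state\<close>

lemma create_vacuum: "create G vacuum M = (if size M = 1 then G (THE k. M = {#k#}) else 0)"
proof (cases "size M = 1")
  case True
  then obtain k where "M = {#k#}" using size_1_singleton_mset by auto
  then show ?thesis by (simp add: create_def vacuum_def)
next
  case False
  have "M - {#k#} \<noteq> {#}" if "k \<in># M" for k
    using False that by (metis One_nat_def insert_DiffM size_single)
  then have "(\<Sum>k\<in>#M. G k * vacuum (M - {#k#})) = (\<Sum>k\<in>#M. 0)"
    by (intro arg_cong[where f=sum_mset] image_mset_cong) (auto simp: vacuum_def)
  then show ?thesis using False by (simp add: create_def)
qed

lemma one_particle_singleton: "one_particle g {#k#} = cnj (fourier g k)"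
  by (simp add: one_particle_def smeared_field_adjoint_def annihilate_vacuum create_vacuum mode_id)

lemma one_particle_eq_0: "size M \<noteq> 1 \<Longrightarrow> one_particle g M = 0"
  by (simp add: one_particle_def smeared_field_adjoint_def annihilate_vacuum create_vacuum)

lemma dfield_vacuum:
  "dfield X h vacuum {#k#} = - mode X (vderiv h) (- k)"
  "size M \<noteq> 1 \<Longrightarrow> dfield X h vacuum M = 0"
  by (simp_all add: dfield_def smeared_field_def annihilate_vacuum create_vacuum)

text \<open>The field changes the particle number by one, so one particle leads to none or to two.
  The factor \<open>1 / sqrt 2\<close> is the normalization in \<open>create\<close> at size 2, and
  the two summands are the choices of which particle the field created.\<close>

lemma dfield_one_particle:
  "dfield X h (one_particle g) {#} = - (\<integral>k. mode X (vderiv h) k * cnj (fourier g k) \<partial>dk2k)"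
  "dfield X h (one_particle g) {#k, l#} = - complex_of_real (1 / sqrt 2) *
      (mode X (vderiv h) (- k) * cnj (fourier g l) + mode X (vderiv h) (- l) * cnj (fourier g k))"
  "size M \<noteq> 0 \<Longrightarrow> size M \<noteq> 2 \<Longrightarrow> dfield X h (one_particle g) M = 0"
proof -
  show "dfield X h (one_particle g) {#} = - (\<integral>k. mode X (vderiv h) k * cnj (fourier g k) \<partial>dk2k)"
    by (simp add: dfield_def smeared_field_def annihilate_def create_def one_particle_singleton)
  have "annihilate F (one_particle g) M = 0" if "size M \<noteq> 0" for F M
    using that by (simp add: annihilate_def one_particle_eq_0)
  note [simp] = this
  show "dfield X h (one_particle g) {#k, l#} = - complex_of_real (1 / sqrt 2) *
      (mode X (vderiv h) (- k) * cnj (fourier g l) + mode X (vderiv h) (- l) * cnj (fourier g k))"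
    by (simp add: dfield_def smeared_field_def create_def one_particle_singleton)
  show "dfield X h (one_particle g) M = 0" if "size M \<noteq> 0" "size M \<noteq> 2"
  proof -
    have "create B (one_particle g) M = 0" for B
    proof -
      have "(\<Sum>k\<in>#M. B k * one_particle g (M - {#k#})) = (\<Sum>k\<in>#M. 0)"
        using that by (intro arg_cong[where f=sum_mset] image_mset_cong)
          (auto simp: size_Diff_singleton intro!: one_particle_eq_0)
      then show ?thesis by (simp add: create_def)
    qed
    then show ?thesis using that by (simp add: dfield_def smeared_field_def)
  qed
qed

lemma fock_inner_dfield_vacuum:
  assumes "integrable dk2k (\<lambda>k. cnj (mode X (vderiv f) (- k)) * mode X (vderiv h) (- k))"
  shows "fock_inner (dfield X f vacuum) (dfield X h vacuum)
    = (\<integral>k. cnj (mode X (vderiv f) (- k)) * mode X (vderiv h) (- k) \<partial>dk2k)"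
proof -
  have "fock_inner (dfield X f vacuum) (dfield X h vacuum)
     = (\<Sum>n\<in>{Suc 0}. \<integral>\<omega>. cnj (dfield X f vacuum (image_mset \<omega> (mset_set {..<n}))) *
            dfield X h vacuum (image_mset \<omega> (mset_set {..<n})) \<partial>(PiM {..<n} (\<lambda>_. dk2k)))"
    unfolding fock_inner_def by (rule suminf_finite) (auto simp: dfield_vacuum(2))
  also have "\<dots> = (\<integral>\<omega>. (\<lambda>k. cnj (mode X (vderiv f) (- k)) * mode X (vderiv h) (- k)) (\<omega> 0) \<partial>(PiM {..<Suc 0} (\<lambda>_. dk2k)))"
    by (simp add: mset_set_lessThan_small dfield_vacuum(1) del: lessThan_Suc)
  also have "\<dots> = (\<integral>k. cnj (mode X (vderiv f) (- k)) * mode X (vderiv h) (- k) \<partial>dk2k)"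
    by (rule integral_PiM_1) (rule assms)
  finally show ?thesis .
qed

text \<open>The zero-particle component is the last summand. On two particles each side is a
  symmetrized product, so expanding gives four products over the two momenta. They agree in pairs
  after integration, which cancels the \<open>1 / 2\<close> coming from the two factors
  \<open>1 / sqrt 2\<close>.\<close>

lemma fock_inner_dfield_one_particle:
  fixes g :: "real \<Rightarrow> complex" and X :: "real \<Rightarrow> real"
  defines "B \<equiv> \<lambda>h k. mode X (vderiv h) (- k)" and "G \<equiv> \<lambda>k. cnj (fourier g k)"
  assumes int: "integrable dk2k (\<lambda>k. cnj (B f k) * B h k)" "integrable dk2k (\<lambda>k. cnj (G k) * G k)"
    "integrable dk2k (\<lambda>k. cnj (B f k) * G k)" "integrable dk2k (\<lambda>k. cnj (G k) * B h k)"
  shows "fock_inner (dfield X f (one_particle g)) (dfield X h (one_particle g))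
    = (\<integral>k. cnj (B f k) * B h k \<partial>dk2k) * (\<integral>k. cnj (G k) * G k \<partial>dk2k)
     + (\<integral>k. cnj (B f k) * G k \<partial>dk2k) * (\<integral>k. cnj (G k) * B h k \<partial>dk2k)
     + cnj (\<integral>k. mode X (vderiv f) k * G k \<partial>dk2k) * (\<integral>k. mode X (vderiv h) k * G k \<partial>dk2k)"
proof -
  let ?M = "\<lambda>n. PiM {..<n} (\<lambda>_::nat. dk2k)"
  let ?I = "\<lambda>n. \<integral>\<omega>. cnj (dfield X f (one_particle g) (image_mset \<omega> (mset_set {..<n}))) *
            dfield X h (one_particle g) (image_mset \<omega> (mset_set {..<n})) \<partial>(?M n)"
  have "fock_inner (dfield X f (one_particle g)) (dfield X h (one_particle g)) = (\<Sum>n\<in>{0, 2}. ?I n)"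
    unfolding fock_inner_def by (rule suminf_finite) (auto simp: dfield_one_particle(3))
  also have "\<dots> = ?I 0 + ?I 2" by simp
  also have "?I 0 = cnj (\<integral>k. mode X (vderiv f) k * G k \<partial>dk2k) * (\<integral>k. mode X (vderiv h) k * G k \<partial>dk2k)"
    using integral_PiM_0[of "cnj (\<integral>k. mode X (vderiv f) k * G k \<partial>dk2k) * (\<integral>k. mode X (vderiv h) k * G k \<partial>dk2k)"]
    by (simp add: dfield_one_particle(1) G_def)
  also have "?I 2 = (\<integral>\<omega>. (1/2) * ((cnj (B f (\<omega> 0)) * B h (\<omega> 0)) * (cnj (G (\<omega> 1)) * G (\<omega> 1))
      + (cnj (B f (\<omega> 0)) * G (\<omega> 0)) * (cnj (G (\<omega> 1)) * B h (\<omega> 1))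
      + (cnj (G (\<omega> 0)) * B h (\<omega> 0)) * (cnj (B f (\<omega> 1)) * G (\<omega> 1))
      + (cnj (G (\<omega> 0)) * G (\<omega> 0)) * (cnj (B f (\<omega> 1)) * B h (\<omega> 1))) \<partial>(?M 2))"
  proof (rule Bochner_Integration.integral_cong[OF refl])
    fix \<omega> :: "nat \<Rightarrow> real"
    have s: "complex_of_real (1 / sqrt 2) * complex_of_real (1 / sqrt 2) = 1 / 2"
      by (simp flip: of_real_mult)
    have "cnj (dfield X f (one_particle g) (image_mset \<omega> (mset_set {..<2}))) *
        dfield X h (one_particle g) (image_mset \<omega> (mset_set {..<2}))
      = (complex_of_real (1 / sqrt 2) * complex_of_real (1 / sqrt 2)) *
        ((cnj (B f (\<omega> 0)) * cnj (G (\<omega> 1)) + cnj (B f (\<omega> 1)) * cnj (G (\<omega> 0))) *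
         (B h (\<omega> 0) * G (\<omega> 1) + B h (\<omega> 1) * G (\<omega> 0)))"
      by (simp add: mset_set_lessThan_small dfield_one_particle(2) B_def G_def)
    then show "cnj (dfield X f (one_particle g) (image_mset \<omega> (mset_set {..<2}))) *
        dfield X h (one_particle g) (image_mset \<omega> (mset_set {..<2})) =
      (1/2) * ((cnj (B f (\<omega> 0)) * B h (\<omega> 0)) * (cnj (G (\<omega> 1)) * G (\<omega> 1))
      + (cnj (B f (\<omega> 0)) * G (\<omega> 0)) * (cnj (G (\<omega> 1)) * B h (\<omega> 1))
      + (cnj (G (\<omega> 0)) * B h (\<omega> 0)) * (cnj (B f (\<omega> 1)) * G (\<omega> 1))
      + (cnj (G (\<omega> 0)) * G (\<omega> 0)) * (cnj (B f (\<omega> 1)) * B h (\<omega> 1)))"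
      unfolding s by (simp add: algebra_simps)
  qed
  also have "\<dots> = (1/2) * ((\<integral>k. cnj (B f k) * B h k \<partial>dk2k) * (\<integral>k. cnj (G k) * G k \<partial>dk2k)
     + (\<integral>k. cnj (B f k) * G k \<partial>dk2k) * (\<integral>k. cnj (G k) * B h k \<partial>dk2k)
     + (\<integral>k. cnj (G k) * B h k \<partial>dk2k) * (\<integral>k. cnj (B f k) * G k \<partial>dk2k)
     + (\<integral>k. cnj (G k) * G k \<partial>dk2k) * (\<integral>k. cnj (B f k) * B h k \<partial>dk2k))"
    using integral_PiM_2[OF int(1,2)] integral_PiM_2[OF int(3,4)]
      integral_PiM_2[OF int(4,3)] integral_PiM_2[OF int(2,1)]
    by simp
  also have "\<dots> = (\<integral>k. cnj (B f k) * B h k \<partial>dk2k) * (\<integral>k. cnj (G k) * G k \<partial>dk2k)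
     + (\<integral>k. cnj (B f k) * G k \<partial>dk2k) * (\<integral>k. cnj (G k) * B h k \<partial>dk2k)"
    by (simp add: algebra_simps)
  finally show ?thesis by (simp add: algebra_simps)
qed

section \<open>Smooth bump functions and uniqueness of correlators\<close>

lemma smooth_vderiv: "smooth f \<Longrightarrow> smooth (vderiv f)"
  unfolding smooth_def by (metis funpow_swap1 funpow.simps(2) comp_apply)

lemma smooth_has_vector_derivative: "smooth f \<Longrightarrow> (f has_vector_derivative vderiv f x) (at x)"
  unfolding smooth_def vderiv_def by (metis funpow_0 vector_derivative_works)

lemma smooth_continuous_on: "smooth f \<Longrightarrow> continuous_on A f"
  by (meson continuous_at_imp_continuous_on has_vector_derivative_continuous smooth_has_vector_derivative)

text \<open>Coinduction: a class of functions closed under differentiation contains all iterated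
  derivatives of its members, so no formula for the n-th derivative is required.\<close>

lemma smooth_coinduct:
  assumes "P f" and step: "\<And>f. P f \<Longrightarrow> \<exists>f'. (\<forall>x. (f has_vector_derivative f' x) (at x)) \<and> P f'"
  shows "smooth f"
proof -
  have *: "(\<forall>x. (u has_vector_derivative vderiv u x) (at x)) \<and> P (vderiv u)" if u: "P u" for u
  proof -
    obtain u' where u': "\<forall>x. (u has_vector_derivative u' x) (at x)" "P u'"
      using step[OF u] by blast
    then have "vderiv u = u'" unfolding vderiv_def by (auto intro: vector_derivative_at)
    then show ?thesis using u' by simp
  qed
  have "P ((vderiv ^^ n) f)" for n
    by (induction n) (use assms(1) * in auto)
  then show ?thesis
    unfolding smooth_def using * differentiableI_vector by blast
qed

lemma has_real_derivative_0_comparison: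
  fixes f h :: "real \<Rightarrow> real"
  assumes "\<And>x. \<bar>f x\<bar> \<le> \<bar>h x\<bar>" "h a = 0" "(h has_real_derivative 0) (at a)"
  shows "(f has_real_derivative 0) (at a)"
proof -
  have fa: "f a = 0" using assms(1)[of a] assms(2) by simp
  have "((\<lambda>t. (h (a + t) - h a) / t) \<longlongrightarrow> 0) (at 0)"
    using assms(3) by (simp add: DERIV_def)
  then have "((\<lambda>t. (f (a + t) - f a) / t) \<longlongrightarrow> 0) (at 0)"
    by (rule tendsto_0_le[where K=1])
       (use assms(1,2) fa in \<open>auto intro!: always_eventually divide_right_mono simp: abs_divide\<close>)
  then show ?thesis by (simp add: DERIV_def)
qed

text \<open>The classical flat functions \<open>R / u^m * exp (- 1 / u)\<close>. Numerator and
  exponent are left free so that, for fixed \<open>u\<close>, the family is closed under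
  differentiation and can be fed to \<open>smooth_coinduct\<close>.\<close>

definition flat :: "real poly \<Rightarrow> real poly \<Rightarrow> nat \<Rightarrow> real \<Rightarrow> real" where
  "flat u R m x = (if poly u x > 0 then poly R x / poly u x ^ m * exp (- 1 / poly u x) else 0)"

text \<open>With \<open>n = m + 2\<close>, \<open>exp (1 / u)\<close> is at least
  \<open>(1 / (n * u))^n\<close>, hence \<open>exp (- 1 / u) / u^m\<close> is at most
  \<open>n^n * u^2\<close>. Two surplus powers of \<open>u\<close> are kept because the bound must
  have derivative 0 where \<open>u\<close> vanishes.\<close>

lemma flat_le: "\<bar>flat u R m x\<bar> \<le> \<bar>real (m + 2) ^ (m + 2) * poly R x * poly u x ^ 2\<bar>"
proof (cases "poly u x > 0")
  case True
  let ?u = "poly u x" and ?n = "m + 2"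
  have pos: "?u ^ ?n > 0" using True by simp
  have "(1 / ?u / real ?n) ^ ?n \<le> (1 + 1 / ?u / real ?n) ^ ?n"
    using True by (intro power_mono) auto
  also have "\<dots> \<le> exp (1 / ?u)"
    by (rule exp_ge_one_plus_x_over_n_power_n)
       (use True in \<open>auto intro: order_trans[of _ 0]\<close>)
  finally have le: "(1 / ?u / real ?n) ^ ?n \<le> exp (1 / ?u)" .
  have "1 / (v ^ n * N ^ n) \<le> E \<Longrightarrow> 1 / E \<le> N ^ n * v ^ n" if "v > 0" "N > 0" "E > 0" for v N E :: real and n
    using that by (simp add: field_simps)
  from this[of ?u "real ?n" "exp (1 / ?u)" ?n] le True have "exp (- 1 / ?u) \<le> real ?n ^ ?n * ?u ^ ?n"
    by (simp add: exp_minus inverse_eq_divide power_divide power_mult_distrib del: power_Suc)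
  also have "\<dots> = (real ?n ^ ?n * ?u ^ 2) * ?u ^ m"
    by (simp only: power_add mult_ac)
  finally have "exp (- 1 / ?u) / ?u ^ m \<le> real ?n ^ ?n * ?u ^ 2"
    using True by (subst pos_divide_le_eq) auto
  then have "\<bar>poly R x\<bar> * (exp (- 1 / ?u) / ?u ^ m) \<le> \<bar>poly R x\<bar> * (real ?n ^ ?n * ?u ^ 2)"
    by (rule mult_left_mono) simp
  then show ?thesis using True by (simp add: flat_def abs_mult mult_ac)
qed (simp add: flat_def)

text \<open>Where \<open>u\<close> is positive, collecting the product rule over the denominator
  \<open>u^(m + 2)\<close> gives the new numerator; at a zero of \<open>u\<close> the quadratic
  bound \<open>flat_le\<close> forces derivative 0.\<close>

lemma flat_has_real_derivative:
  "(flat u R m has_real_derivative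
     flat u (pderiv R * u\<^sup>2 - smult (real m) (R * pderiv u * u) + R * pderiv u) (m + 2) x) (at x)"
proof -
  consider "poly u x > 0" | "poly u x < 0" | "poly u x = 0" by linarith
  then show ?thesis
  proof cases
    case 1
    have o: "open {x. poly u x > 0}" by (intro open_Collect_less continuous_intros)
    let ?p = "poly R x" and ?u = "poly u x" and ?p' = "poly (pderiv R) x" and ?u' = "poly (pderiv u) x"
    have "((\<lambda>x. poly R x * inverse (poly u x) ^ m * exp (- inverse (poly u x))) has_real_derivative
        ?p' * inverse ?u ^ m * exp (- inverse ?u)
        + ?p * (real m * inverse ?u ^ (m - 1) * (- (inverse ?u ^ 2 * ?u'))) * exp (- inverse ?u)
        + ?p * inverse ?u ^ m * (exp (- inverse ?u) * (inverse ?u ^ 2 * ?u'))) (at x)"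
      using 1 by (auto intro!: derivative_eq_intros simp: algebra_simps power2_eq_square)
    moreover have field_id: "p' * q * E + p * (n * j * (- (i ^ 2 * u'))) * E + p * q * (E * (i ^ 2 * u'))
      = (p' - n * p * u' * i + p * u' * i ^ 2) * q * E" if "n * j * i = n * q" for p' q E p n j i u' :: real
    proof -
      have "p * (n * j * (- (i ^ 2 * u'))) * E = - (p * u' * i * E) * (n * j * i)"
        by (simp add: power2_eq_square)
      also have "\<dots> = - (p * u' * i * E) * (n * q)" unfolding that ..
      finally have e: "p * (n * j * (- (i ^ 2 * u'))) * E = - (p * u' * i * E) * (n * q)" .
      show ?thesis unfolding e by (simp add: algebra_simps)
    qed
    \<comment> \<open>For \<open>m = 0\<close> the exponent \<open>m - 1\<close> truncates to 0, but
      the factor \<open>real m\<close> makes both sides 0.\<close>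
    have "real m * inverse ?u ^ (m - 1) * inverse ?u = real m * inverse ?u ^ m"
      by (cases m) auto
    then have "?p' * inverse ?u ^ m * exp (- inverse ?u)
        + ?p * (real m * inverse ?u ^ (m - 1) * (- (inverse ?u ^ 2 * ?u'))) * exp (- inverse ?u)
        + ?p * inverse ?u ^ m * (exp (- inverse ?u) * (inverse ?u ^ 2 * ?u'))
      = (?p' - real m * ?p * ?u' * inverse ?u + ?p * ?u' * inverse ?u ^ 2) * inverse ?u ^ m * exp (- inverse ?u)"
      by (rule field_id)
    moreover have "\<dots> = flat u (pderiv R * u\<^sup>2 - smult (real m) (R * pderiv u * u) + R * pderiv u) (m + 2) x"
      using 1 by (simp add: flat_def power_add power2_eq_square field_simps)
    ultimately have "((\<lambda>x. poly R x * inverse (poly u x) ^ m * exp (- inverse (poly u x))) has_real_derivative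
        flat u (pderiv R * u\<^sup>2 - smult (real m) (R * pderiv u * u) + R * pderiv u) (m + 2) x) (at x)"
      by simp
    then show ?thesis
      by (rule has_field_derivative_transform_within_open[OF _ o]) (use 1 in \<open>auto simp: flat_def field_simps\<close>)
  next
    case 2
    have o: "open {x. poly u x < 0}" by (intro open_Collect_less continuous_intros)
    have "((\<lambda>x. 0::real) has_real_derivative 0) (at x)" by simp
    then have "(flat u R m has_real_derivative 0) (at x)"
      by (rule has_field_derivative_transform_within_open[OF _ o]) (use 2 in \<open>auto simp: flat_def\<close>)
    then show ?thesis using 2 by (simp add: flat_def)
  next
    case 3
    have "(flat u R m has_real_derivative 0) (at x)"
    proof (rule has_real_derivative_0_comparison[OF flat_le])
      show "((\<lambda>x. real (m + 2) ^ (m + 2) * poly R x * (poly u x)\<^sup>2) has_real_derivative 0) (at x)"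
        using 3 by (auto intro!: derivative_eq_intros)
    qed (simp add: 3)
    then show ?thesis using 3 by (simp add: flat_def)
  qed
qed

lemma smooth_flat: "smooth (\<lambda>x. complex_of_real (flat u R m x))"
proof (rule smooth_coinduct[where P = "\<lambda>f. \<exists>R m. f = (\<lambda>x. complex_of_real (flat u R m x))"], blast)
  fix f assume "\<exists>R m. f = (\<lambda>x. complex_of_real (flat u R m x))"
  then obtain R m where f: "f = (\<lambda>x. complex_of_real (flat u R m x))" by blast
  show "\<exists>f'. (\<forall>x. (f has_vector_derivative f' x) (at x)) \<and> (\<exists>R m. f' = (\<lambda>x. complex_of_real (flat u R m x)))"
    unfolding f
    by (rule exI[of _ "\<lambda>x. complex_of_real (flat u (pderiv R * u\<^sup>2 - smult (real m) (R * pderiv u * u) + R * pderiv u) (m + 2) x)"])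
       (blast intro: has_vector_derivative_of_real flat_has_real_derivative)
qed

lemma test_fun_bump:
  fixes c r :: real
  assumes "r > 0"
  obtains b :: "real \<Rightarrow> real" where "test_fun (\<lambda>x. complex_of_real (b x))" "\<And>x. b x \<ge> 0"
    "\<And>x. b x > 0 \<longleftrightarrow> \<bar>x - c\<bar> < r" "supp (\<lambda>x. complex_of_real (b x)) \<subseteq> {c - r..c + r}"
proof -
  \<comment> \<open>The coefficients of \<open>r^2 - (x - c)^2\<close>, which is positive exactly
    within distance \<open>r\<close> of \<open>c\<close>.\<close>
  define u where "u = [:r\<^sup>2 - c\<^sup>2, 2 * c, - 1:]"
  have u: "poly u x = r\<^sup>2 - (x - c)\<^sup>2" for x
    by (simp add: u_def power2_eq_square algebra_simps)
  have pos: "poly u x > 0 \<longleftrightarrow> \<bar>x - c\<bar> < r" for x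
    unfolding u using abs_le_square_iff[of r "x - c"] assms by auto
  define b where "b = flat u 1 0"
  have b: "b x \<ge> 0" "b x > 0 \<longleftrightarrow> \<bar>x - c\<bar> < r" for x
    by (auto simp: b_def flat_def pos)
  have sub: "supp (\<lambda>x. complex_of_real (b x)) \<subseteq> {c - r..c + r}"
    unfolding supp_def
  proof (rule closure_minimal)
    have "\<bar>x - c\<bar> < r" if "b x \<noteq> 0" for x
      using that b[of x] by linarith
    then show "{x. complex_of_real (b x) \<noteq> 0} \<subseteq> {c - r..c + r}" by force
  qed simp
  moreover have "compact (supp (\<lambda>x. complex_of_real (b x)))"
    using sub by (metis supp_def bounded_closed_interval bounded_subset closed_closure compact_eq_bounded_closed)
  ultimately show ?thesis
    using b smooth_flat[of u 1 0] by (intro that) (auto simp: test_fun_def b_def)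
qed

lemma integral_pos_of_continuous:
  fixes b :: "real \<Rightarrow> real"
  assumes "integrable lborel b" "\<And>x. b x \<ge> 0" "r > 0" "\<And>x. \<bar>x - c\<bar> < r \<Longrightarrow> b x > 0"
  shows "integral\<^sup>L lborel b > 0"
proof (rule ccontr)
  assume "\<not> ?thesis"
  then have "integral\<^sup>L lborel b = 0" using assms(2) by (meson Bochner_Integration.integral_nonneg antisym not_le)
  then have "AE x in lborel. b x = 0"
    using integral_nonneg_eq_0_iff_AE[OF assms(1)] assms(2) by simp
  then have "AE x in lborel. x \<notin> {c - r<..<c + r}"
  proof eventually_elim
    case (elim x)
    then show ?case using assms(4)[of x] by (auto simp: abs_less_iff)
  qed
  then have "emeasure lborel {c - r<..<c + r} = 0"
    using AE_iff_null_sets[of "{c - r<..<c + r}" lborel] by auto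
  then show False using \<open>r > 0\<close> by (simp add: emeasure_lborel_Ioo)
qed

section \<open>Compact supports and uniqueness of the correlator off the diagonal\<close>

lemma integrable_compact_support:
  fixes f :: "'a::euclidean_space \<Rightarrow> 'b::{banach, second_countable_topology}"
  assumes "compact S" "continuous_on S f" "\<And>x. x \<notin> S \<Longrightarrow> f x = 0"
  shows "integrable lborel f"
proof -
  have "(\<lambda>x. indicator S x *\<^sub>R f x) = f"
    using assms(3) by (auto simp: fun_eq_iff indicator_def)
  then show ?thesis using borel_integrable_compact[OF assms(1,2)] by simp
qed

lemma test_fun_zero: "x \<notin> supp f \<Longrightarrow> f x = 0"
  using closure_subset[of "{x. f x \<noteq> 0}"] by (auto simp: supp_def)

text \<open>If the values differed by some \<open>c \<noteq> 0\<close>, then by continuity the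
  difference would stay within \<open>cmod c / 2\<close> of \<open>c\<close> near
  \<open>(y, y')\<close>. Bump functions supported there would smear it to a nonzero number,
  although both candidates give the same matrix element.\<close>

lemma is_correlator_unique:
  assumes w1: "is_correlator X \<Psi> w1" and w2: "is_correlator X \<Psi> w2" and ne: "y \<noteq> y'"
  shows "w1 y y' = w2 y y'"
proof (rule ccontr)
  assume "w1 y y' \<noteq> w2 y y'"
  define c where "c = w1 y y' - w2 y y'"
  have c: "c \<noteq> 0" using \<open>w1 y y' \<noteq> w2 y y'\<close> by (simp add: c_def)
  define S where "S = {(a, b). a \<noteq> (b::real)}"
  define d where "d = (\<lambda>p. w1 (fst p) (snd p) - w2 (fst p) (snd p))"
  have cont: "continuous_on S (\<lambda>p. w1 (fst p) (snd p))" "continuous_on S (\<lambda>p. w2 (fst p) (snd p))"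
    using w1 w2 by (auto simp: is_correlator_def S_def case_prod_unfold)
  then have contd: "continuous_on S d" unfolding d_def by (intro continuous_intros)
  have "S = {p. fst p \<noteq> snd p}" by (auto simp: S_def)
  then have openS: "open S" by (simp add: open_Collect_neq continuous_on_fst continuous_on_snd)
  have yS: "(y, y') \<in> S" using ne by (simp add: S_def)
  have "isCont d (y, y')"
    using contd openS yS by (simp add: continuous_on_eq_continuous_at)
  then obtain e where e: "e > 0" "\<And>p. dist p (y, y') < e \<Longrightarrow> dist (d p) (d (y, y')) < cmod c / 2"
  proof -
    have "cmod c / 2 > 0" using c by simp
    then show ?thesis using \<open>isCont d (y, y')\<close> that unfolding continuous_at_eps_delta by meson
  qed
  obtain e' where e': "e' > 0" "\<And>p. dist p (y, y') < e' \<Longrightarrow> p \<in> S"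
    using openS yS unfolding open_dist by blast
  \<comment> \<open>With a third of the smaller radius, every point of the box \<open>K\<close> is
    at distance at most \<open>2 * r\<close> from the centre, so the closed box lies in both
    neighbourhoods.\<close>
  define r where "r = min e e' / 3"
  have r: "r > 0" using e e' by (simp add: r_def)
  define K where "K = {y - r..y + r} \<times> {y' - r..y' + r}"
  have Kd: "dist p (y, y') < min e e'" if "p \<in> K" for p
  proof -
    have "dist p (y, y') \<le> \<bar>fst p - y\<bar> + \<bar>snd p - y'\<bar>"
      unfolding dist_prod_def dist_real_def by (simp add: sqrt_sum_squares_le_sum_abs)
    also have "\<dots> \<le> r + r" using that by (intro add_mono) (auto simp: K_def)
    also have "\<dots> < min e e'" using e(1) e'(1) by (simp add: r_def min_def)
    finally show ?thesis .
  qed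
  have KS: "K \<subseteq> S" using Kd e' by auto
  have Kc: "cmod (d p - c) \<le> cmod c / 2" if "p \<in> K" for p
    using e(2)[of p] Kd[OF that] by (simp add: d_def c_def dist_norm)
  have Kcomp: "compact K" unfolding K_def by (intro compact_Times) auto
  obtain b1 where b1: "test_fun (\<lambda>x. complex_of_real (b1 x))" "\<And>x. b1 x \<ge> 0"
    "\<And>x. b1 x > 0 \<longleftrightarrow> \<bar>x - y\<bar> < r" "supp (\<lambda>x. complex_of_real (b1 x)) \<subseteq> {y - r..y + r}"
    by (rule test_fun_bump[OF r, of y]) (rule that)
  obtain b2 where b2: "test_fun (\<lambda>x. complex_of_real (b2 x))" "\<And>x. b2 x \<ge> 0"
    "\<And>x. b2 x > 0 \<longleftrightarrow> \<bar>x - y'\<bar> < r" "supp (\<lambda>x. complex_of_real (b2 x)) \<subseteq> {y' - r..y' + r}"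
    by (rule test_fun_bump[OF r, of y']) (rule that)
  \<comment> \<open>A common point \<open>x\<close> of the supports would put \<open>(x, x)\<close>
    into \<open>K\<close>, which avoids the diagonal.\<close>
  have disj: "supp (\<lambda>x. complex_of_real (b1 x)) \<inter> supp (\<lambda>x. complex_of_real (b2 x)) = {}"
  proof -
    have "x \<notin> supp (\<lambda>x. complex_of_real (b2 x))" if "x \<in> supp (\<lambda>x. complex_of_real (b1 x))" for x
    proof
      assume "x \<in> supp (\<lambda>x. complex_of_real (b2 x))"
      then have "(x, x) \<in> K" using that b1(4) b2(4) by (auto simp: K_def)
      then show False using KS by (auto simp: S_def)
    qed
    then show ?thesis by blast
  qed
  have contc: "continuous_on UNIV (\<lambda>x. complex_of_real (b1 x))" "continuous_on UNIV (\<lambda>x. complex_of_real (b2 x))"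
    using b1(1) b2(1) smooth_continuous_on unfolding test_fun_def by blast+
  have "continuous_on UNIV (\<lambda>x. Re (complex_of_real (b1 x)))" "continuous_on UNIV (\<lambda>x. Re (complex_of_real (b2 x)))"
    by (intro continuous_intros contc)+
  then have contb: "continuous_on UNIV b1" "continuous_on UNIV b2" by simp_all
  have bK: "b1 (fst p) * b2 (snd p) = 0" if "p \<notin> K" for p
  proof -
    have "fst p \<notin> supp (\<lambda>x. complex_of_real (b1 x)) \<or> snd p \<notin> supp (\<lambda>x. complex_of_real (b2 x))"
      using that b1(4) b2(4) by (cases p) (auto simp: K_def)
    then show ?thesis using test_fun_zero by fastforce
  qed
  have contbb: "continuous_on K (\<lambda>p. b1 (fst p) * b2 (snd p))"
    by (intro continuous_intros continuous_on_compose2[OF contb(1)] continuous_on_compose2[OF contb(2)]) auto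
  define F where "F w p = complex_of_real (b1 (fst p) * b2 (snd p)) * w (fst p) (snd p)" for w :: "real \<Rightarrow> real \<Rightarrow> complex" and p
  have intF: "integrable lborel (F w)" if "continuous_on S (\<lambda>p. w (fst p) (snd p))" for w
  proof -
    have "F w p = 0" if "p \<notin> K" for p
      using bK[OF that] by (auto simp: F_def)
    moreover have "continuous_on K (F w)"
      unfolding F_def by (intro continuous_intros continuous_on_of_real contbb continuous_on_subset[OF that KS])
    ultimately show ?thesis by (intro integrable_compact_support[OF Kcomp])
  qed
  have eqF: "fock_inner (dfield X (\<lambda>x. complex_of_real (b1 x)) \<Psi>) (dfield X (\<lambda>x. complex_of_real (b2 x)) \<Psi>) = integral\<^sup>L lborel (F w)"
    if "is_correlator X \<Psi> w" for w
  proof -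
    have "continuous_on S (\<lambda>p. w (fst p) (snd p))"
      using that by (auto simp: is_correlator_def S_def case_prod_unfold)
    then have "integrable (lborel \<Otimes>\<^sub>M lborel) (F w)" using intF by (simp add: lborel_prod)
    then have "(\<integral>a. (\<integral>b. F w (a, b) \<partial>lborel) \<partial>lborel) = integral\<^sup>L lborel (F w)"
      using lborel_pair.integral_fst'[of "F w"] by (simp add: lborel_prod)
    moreover have "fock_inner (dfield X (\<lambda>x. complex_of_real (b1 x)) \<Psi>) (dfield X (\<lambda>x. complex_of_real (b2 x)) \<Psi>)
       = (\<integral>a. (\<integral>b. F w (a, b) \<partial>lborel) \<partial>lborel)"
      using that b1(1) b2(1) disj unfolding is_correlator_def by (simp add: F_def)
    ultimately show ?thesis by simp
  qed
  have 0: "integral\<^sup>L lborel (F w1) = integral\<^sup>L lborel (F w2)"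
    using eqF[OF w1] eqF[OF w2] by simp
  \<comment> \<open>Multiplying by \<open>cnj c\<close> turns closeness of \<open>d p\<close> to
    \<open>c\<close> into positivity of a real part: on \<open>K\<close>, \<open>H\<close> is at
    least \<open>(cmod c)^2 / 2\<close> times the weight, and outside \<open>K\<close> both are
    0.\<close>
  define H where "H p = Re (cnj c * (F w1 p - F w2 p))" for p
  have intH: "integrable lborel H" unfolding H_def
    by (intro integrable_Re integrable_mult_right Bochner_Integration.integrable_diff intF cont)
  have "integral\<^sup>L lborel H = Re (cnj c * (integral\<^sup>L lborel (F w1) - integral\<^sup>L lborel (F w2)))"
    unfolding H_def using intF[OF cont(1)] intF[OF cont(2)] by simp
  then have H0: "integral\<^sup>L lborel H = 0" using 0 by simp
  have intb: "integrable lborel (\<lambda>p. b1 (fst p) * b2 (snd p))"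
    by (rule integrable_compact_support[OF Kcomp contbb bK])
  have zb1: "b1 x = 0" if "x \<notin> {y - r..y + r}" for x
    using test_fun_zero[of x "\<lambda>x. complex_of_real (b1 x)"] subsetD[OF b1(4), of x] that by force
  have intb1: "integrable lborel b1"
    by (rule integrable_compact_support[OF compact_Icc continuous_on_subset[OF contb(1) subset_UNIV] zb1])
  have zb2: "b2 x = 0" if "x \<notin> {y' - r..y' + r}" for x
    using test_fun_zero[of x "\<lambda>x. complex_of_real (b2 x)"] subsetD[OF b2(4), of x] that by force
  have intb2: "integrable lborel b2"
    by (rule integrable_compact_support[OF compact_Icc continuous_on_subset[OF contb(2) subset_UNIV] zb2])
  have "(\<integral>p. b1 (fst p) * b2 (snd p) \<partial>lborel) = (\<integral>a. (\<integral>b. b1 a * b2 b \<partial>lborel) \<partial>lborel)"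
    using lborel_pair.integral_fst'[of "\<lambda>p. b1 (fst p) * b2 (snd p)"] intb by (simp add: lborel_prod)
  also have "\<dots> = integral\<^sup>L lborel b1 * integral\<^sup>L lborel b2" by simp
  also have "\<dots> > 0"
    by (intro mult_pos_pos integral_pos_of_continuous[where r=r and c=y] integral_pos_of_continuous[where r=r and c=y'])
       (use b1 b2 r intb1 intb2 in auto)
  finally have pos: "(\<integral>p. b1 (fst p) * b2 (snd p) \<partial>lborel) > 0" .
  have "(\<integral>p. (cmod c)\<^sup>2 / 2 * (b1 (fst p) * b2 (snd p)) \<partial>lborel) \<le> integral\<^sup>L lborel H"
  proof (rule integral_mono)
    fix p
    show "(cmod c)\<^sup>2 / 2 * (b1 (fst p) * b2 (snd p)) \<le> H p"
    proof (cases "p \<in> K")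
      case True
      have H: "H p = b1 (fst p) * b2 (snd p) * Re (cnj c * d p)"
        by (simp add: H_def F_def d_def algebra_simps)
      have "(cmod c)\<^sup>2 = Re (cnj c * c)"
        by (metis Re_complex_of_real complex_norm_square mult.commute)
      moreover have "Re (cnj c * d p) = Re (cnj c * c) + Re (cnj c * (d p - c))"
        by (simp add: algebra_simps)
      moreover have "\<bar>Re (cnj c * (d p - c))\<bar> \<le> cmod c * (cmod c / 2)"
        by (rule order_trans[OF abs_Re_le_cmod])
           (simp only: norm_mult complex_mod_cnj, intro mult_left_mono Kc[OF True] norm_ge_zero)
      ultimately have "(cmod c)\<^sup>2 / 2 \<le> Re (cnj c * d p)"
        unfolding power2_eq_square by linarith
      then show ?thesis unfolding H using b1(2) b2(2)
        by (metis mult.commute mult_left_mono mult_nonneg_nonneg)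
    next
      case False
      then show ?thesis using bK[of p] by (auto simp: H_def F_def simp flip: of_real_mult)
    qed
  qed (use intb intH in auto)
  then have "(cmod c)\<^sup>2 / 2 * (\<integral>p. b1 (fst p) * b2 (snd p) \<partial>lborel) \<le> 0"
    using H0 by simp
  moreover have "(cmod c)\<^sup>2 / 2 * (\<integral>p. b1 (fst p) * b2 (snd p) \<partial>lborel) > 0"
    by (rule mult_pos_pos) (use pos c in auto)
  ultimately show False by linarith
qed

lemma correlator_eq:
  assumes "is_correlator X \<Psi> w" "y \<noteq> y'"
  shows "correlator X \<Psi> y y' = w y y'"
  unfolding correlator_def
  by (rule the_equality) (use assms is_correlator_unique in blast)+

section \<open>Integration by parts and the Laplace transform of k\<close>

lemma integrable_inverse_1_plus_square_real: "integrable lborel (\<lambda>x::real. C / (1 + x\<^sup>2))"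
proof -
  have "integrable lborel (\<lambda>x::real. C * inverse (1 + x\<^sup>2))"
    using integrable_inverse_1_plus_square by (simp add: set_integrable_def)
  then show ?thesis by (simp add: divide_inverse)
qed

lemma integral_vector_derivative_eq_0:
  fixes F :: "real \<Rightarrow> complex"
  assumes F: "\<And>x. (F has_vector_derivative F' x) (at x)"
    and cont: "continuous_on UNIV F'" and int: "integrable lborel F'"
    and lim: "(F \<longlongrightarrow> 0) at_top" "(F \<longlongrightarrow> 0) at_bot"
  shows "integral\<^sup>L lborel F' = 0"
proof -
  have "(LBINT x=-\<infinity>..\<infinity>. F' x) = 0 - 0"
    by (rule interval_integral_FTC_integrable[where F=F])
       (use assms in \<open>auto simp: ereal_tendsto_simps continuous_on_eq_continuous_at set_integrable_def\<close>)
  then show ?thesis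
    by (simp add: interval_lebesgue_integral_def set_lebesgue_integral_def)
qed

lemma tendsto_0_compact_support:
  fixes u :: "real \<Rightarrow> complex"
  assumes "compact S" "\<And>x. x \<notin> S \<Longrightarrow> u x = 0"
  shows "(u \<longlongrightarrow> 0) at_top" "(u \<longlongrightarrow> 0) at_bot"
proof -
  obtain R where R: "\<And>x. x \<in> S \<Longrightarrow> \<bar>x\<bar> \<le> R"
    using compact_imp_bounded[OF assms(1)] unfolding bounded_real by blast
  have "u x = 0" if "\<bar>x\<bar> > R" for x using R[of x] assms(2)[of x] that by force
  then have "eventually (\<lambda>x. u x = 0) at_top" "eventually (\<lambda>x. u x = 0) at_bot"
    by (auto intro!: eventually_mono[OF eventually_gt_at_top[of "\<bar>R\<bar>"]]
        eventually_mono[OF eventually_gt_at_bot[of "- \<bar>R\<bar>"]])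
  then show "(u \<longlongrightarrow> 0) at_top" "(u \<longlongrightarrow> 0) at_bot"
    by (auto intro: tendsto_eventually)
qed

lemma has_vector_derivative_zero_outside:
  assumes "closed S" "\<And>x. x \<notin> S \<Longrightarrow> u x = 0" "(u has_vector_derivative u') (at x)" "x \<notin> S"
  shows "u' = 0"
proof -
  have "((\<lambda>x. 0) has_vector_derivative 0) (at x)" by simp
  then have "(u has_vector_derivative 0) (at x)"
    by (rule has_vector_derivative_transform_within_open[of _ _ _ "- S"]) (use assms in auto)
  then show ?thesis using assms(3) vector_derivative_unique_at by blast
qed

lemma continuous_mode:
  assumes "integrable lborel h" and [measurable]: "X \<in> borel_measurable borel"
  shows "continuous_on UNIV (mode X h)"
proof -
  have [measurable]: "h \<in> borel_measurable borel"
    using borel_measurable_integrable[OF assms(1)] by simp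
  have "isCont (mode X h) k" for k
    unfolding continuous_at_sequentially comp_def
  proof (intro allI impI)
    fix s :: "nat \<Rightarrow> real" assume s: "s \<longlonglongrightarrow> k"
    have "(\<lambda>n. \<integral>y. h y * exp (- \<i> * of_real (s n * X y)) \<partial>lborel)
        \<longlonglongrightarrow> (\<integral>y. h y * exp (- \<i> * of_real (k * X y)) \<partial>lborel)"
    proof (rule integral_dominated_convergence[where w = "\<lambda>y. norm (h y)"])
      show "AE y in lborel. (\<lambda>n. h y * exp (- \<i> * of_real (s n * X y))) \<longlonglongrightarrow> h y * exp (- \<i> * of_real (k * X y))"
        by (intro AE_I2 tendsto_intros s)
    qed (use assms(1) in \<open>auto simp: norm_mult\<close>)
    then show "(\<lambda>n. mode X h (s n)) \<longlonglongrightarrow> mode X h k"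
      unfolding mode_def by (intro tendsto_mult tendsto_const)
  qed
  then show ?thesis by (simp add: continuous_on_eq_continuous_at)
qed

lemma norm_mode_le: "cmod (mode X h k) \<le> (1 / sqrt (2 * pi)) * (\<integral>y. cmod (h y) \<partial>lborel)"
proof -
  have "cmod (\<integral>y. h y * exp (- \<i> * of_real (k * X y)) \<partial>lborel)
      \<le> (\<integral>y. cmod (h y * exp (- \<i> * of_real (k * X y))) \<partial>lborel)"
    by (rule integral_norm_bound)
  then show ?thesis
    by (simp add: mode_def norm_mult norm_divide divide_right_mono)
qed

lemma integrable_mult_exp:
  assumes "integrable lborel h" and [measurable]: "X \<in> borel_measurable borel"
  shows "integrable lborel (\<lambda>y. h y * exp (- \<i> * of_real (k * X y)))"
proof -
  have [measurable]: "h \<in> borel_measurable borel"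
    using borel_measurable_integrable[OF assms(1)] by simp
  show ?thesis
    by (rule Bochner_Integration.integrable_bound[OF assms(1)]) (auto simp: norm_mult)
qed

text \<open>The derivative of \<open>u\<close> times the exponential integrates to 0, and the chain
  rule in the exponent produces \<open>X'\<close>. Decay at infinity is assumed instead of compact
  support, so that Schwartz functions with \<open>X\<close> the identity are covered too.\<close>

lemma mode_derivative:
  fixes u u' :: "real \<Rightarrow> complex"
  assumes X: "\<And>y. (X has_real_derivative X' y) (at y)" and contX': "continuous_on UNIV X'"
    and u: "\<And>y. (u has_vector_derivative u' y) (at y)" and contu': "continuous_on UNIV u'"
    and int: "integrable lborel u'" "integrable lborel (\<lambda>y. u y * of_real (X' y))"
    and lim: "(u \<longlongrightarrow> 0) at_top" "(u \<longlongrightarrow> 0) at_bot"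
  shows "mode X u' k = \<i> * of_real k * mode X (\<lambda>y. u y * of_real (X' y)) k"
proof -
  define E where "E y = exp (- \<i> * of_real (k * X y))" for y
  have contX: "continuous_on UNIV X"
    by (meson X DERIV_isCont continuous_at_imp_continuous_on)
  have contu: "continuous_on UNIV u"
    by (meson u has_vector_derivative_continuous continuous_at_imp_continuous_on)
  have [measurable]: "X \<in> borel_measurable borel"
    by (rule borel_measurable_continuous_onI[OF contX])
  have E: "(E has_vector_derivative (- \<i> * of_real k * of_real (X' y)) * E y) (at y)" for y
  proof -
    have 1: "((\<lambda>y. - \<i> * of_real (k * X y)) has_vector_derivative (- \<i> * of_real (k * X' y))) (at y)"
      by (intro has_vector_derivative_mult_right has_vector_derivative_of_real DERIV_cmult X)
    have "(exp \<circ> (\<lambda>y. - \<i> * of_real (k * X y)) has_vector_derivative (- \<i> * of_real (k * X' y)) * exp (- \<i> * of_real (k * X y))) (at y)"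
      by (rule field_vector_diff_chain_at[OF 1]) (rule DERIV_exp)
    then show ?thesis by (simp add: E_def[abs_def] comp_def mult_ac)
  qed
  have D: "((\<lambda>y. u y * E y) has_vector_derivative (u' y * E y - \<i> * of_real k * (u y * of_real (X' y) * E y))) (at y)" for y
    using has_vector_derivative_mult[OF u[of y] E[of y]] by (simp add: algebra_simps)
  have contE: "continuous_on UNIV E" unfolding E_def by (intro continuous_intros contX)
  have i1: "integrable lborel (\<lambda>y. u' y * E y)" and i2: "integrable lborel (\<lambda>y. u y * of_real (X' y) * E y)"
    unfolding E_def using integrable_mult_exp[OF int(1)] integrable_mult_exp[OF int(2)] by simp_all
  have "(\<integral>y. (u' y * E y - \<i> * of_real k * (u y * of_real (X' y) * E y)) \<partial>lborel) = 0"
  proof (rule integral_vector_derivative_eq_0[OF D])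
    show "continuous_on UNIV (\<lambda>y. u' y * E y - \<i> * of_real k * (u y * of_real (X' y) * E y))"
      by (intro continuous_intros contu' contu contE contX')
    show "integrable lborel (\<lambda>y. u' y * E y - \<i> * of_real k * (u y * of_real (X' y) * E y))"
      by (intro Bochner_Integration.integrable_diff integrable_mult_right i1 i2)
    have n: "norm (u y * E y) \<le> norm (u y) * 1" for y by (simp add: norm_mult E_def)
    show "((\<lambda>y. u y * E y) \<longlongrightarrow> 0) at_top" "((\<lambda>y. u y * E y) \<longlongrightarrow> 0) at_bot"
      by (rule tendsto_0_le[OF lim(1)] tendsto_0_le[OF lim(2)], rule always_eventually, rule allI, rule n)+
  qed
  then have "(\<integral>y. u' y * E y \<partial>lborel) = \<i> * of_real k * (\<integral>y. u y * of_real (X' y) * E y \<partial>lborel)"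
    using i1 i2 by simp
  then show ?thesis by (simp add: mode_def E_def)
qed

lemma integrable_exp_times:
  fixes L :: real
  assumes "L > 0"
  shows "integrable lborel (\<lambda>k. indicator {0<..} k * (k * exp (- L * k)))" (is "integrable _ ?f")
proof -
  have "(\<integral>\<^sup>+(k::real). ennreal (k * exp (- L * k)) * indicator {0..} k \<partial>lborel)
      = ennreal (0 - (- (0 / L + 1 / L\<^sup>2) * exp (- L * 0)))"
  proof (rule nn_integral_FTC_atLeast)
    show "((\<lambda>k. - (k / L + 1 / L\<^sup>2) * exp (- L * k)) has_real_derivative k * exp (- L * k)) (at k)" for k
      using assms by (auto intro!: derivative_eq_intros simp: field_simps power2_eq_square)
    show "((\<lambda>k. - (k / L + 1 / L\<^sup>2) * exp (- L * k)) \<longlongrightarrow> 0) at_top"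
      using assms by real_asymp
  qed auto
  then have "(\<integral>\<^sup>+(k::real). ennreal (k * exp (- L * k)) * indicator {0..} k \<partial>lborel) < \<infinity>" by simp
  moreover have "(\<integral>\<^sup>+k. ennreal (?f k) \<partial>lborel) \<le> (\<integral>\<^sup>+(k::real). ennreal (k * exp (- L * k)) * indicator {0..} k \<partial>lborel)"
    by (intro nn_integral_mono) (auto simp: indicator_def)
  ultimately have "(\<integral>\<^sup>+k. ennreal (?f k) \<partial>lborel) < \<infinity>" using order.strict_trans1 by blast
  then show ?thesis by (intro integrableI_nonneg) (auto simp: indicator_def)
qed

lemma integral_exp_times:
  fixes L D :: real
  assumes "L > 0"
  shows "(\<integral>k. of_real (indicator {0<..} k * (k * exp (- L * k))) * exp (- \<i> * of_real (k * D)) \<partial>lborel)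
    = 1 / (of_real L + \<i> * of_real D)\<^sup>2"
proof -
  define z where "z = of_real L + \<i> * of_real D"
  have Rez: "Re z > 0" using assms by (simp add: z_def)
  then have z0: "z \<noteq> 0" by auto
  define f where "f k = of_real k * exp (- z * of_real k)" for k :: real
  \<comment> \<open>The antiderivative of \<open>f\<close> that vanishes at infinity; its value at 0
    is \<open>- 1 / z^2\<close>.\<close>
  define F where "F k = - (of_real k / z + 1 / z\<^sup>2) * exp (- z * of_real k)" for k :: real
  have eq: "of_real (indicator {0<..} k * (k * exp (- L * k))) * exp (- \<i> * of_real (k * D)) = indicator {0<..} k *\<^sub>R f k" for k
  proof -
    have "of_real (exp (- L * k)) * exp (- \<i> * of_real (k * D)) = exp (- z * of_real k)"
      by (simp add: z_def exp_of_real[symmetric] exp_add[symmetric] algebra_simps)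
    then show ?thesis by (simp add: f_def indicator_def mult.assoc)
  qed
  have "integrable lborel (\<lambda>k. complex_of_real (indicator {0<..} k * (k * exp (- L * k))))"
    using integrable_exp_times[OF assms] by (rule integrable_of_real)
  from integrable_mult_exp[OF this, of "\<lambda>x. x" D]
  have "integrable lborel (\<lambda>k. indicator {0<..} k *\<^sub>R f k)"
    unfolding eq[symmetric] by (simp add: mult.commute)
  then have int: "set_integrable lborel (einterval 0 \<infinity>) f"
    by (simp add: set_integrable_def zero_ereal_def einterval_def indicator_def greaterThan_def)
  have dF: "(F has_vector_derivative f x) (at x)" for x
  proof -
    have "((\<lambda>w. - (w / z + 1 / z\<^sup>2) * exp (- z * w)) has_field_derivative (w * exp (- z * w))) (at w)" for w
      using z0 by (auto intro!: derivative_eq_intros simp: field_simps power2_eq_square)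
    from has_vector_derivative_real_field[OF this] show ?thesis
      by (simp add: F_def[abs_def] f_def)
  qed
  have "(LBINT x=0..\<infinity>. f x) = 0 - F 0"
  proof (rule interval_integral_FTC_integrable[where F=F])
    show "isCont f x" for x unfolding f_def by (intro continuous_intros)
    have "isCont F 0" using dF has_vector_derivative_continuous by blast
    then have "(F \<longlongrightarrow> F 0) (at_right 0)" by (simp add: isCont_def filterlim_at_split)
    then show "((F \<circ> real_of_ereal) \<longlongrightarrow> F 0) (at_right 0)"
      by (simp add: zero_ereal_def ereal_tendsto_simps)
    have "((\<lambda>k. (k / cmod z + 1 / cmod z ^ 2) * exp (- L * k)) \<longlongrightarrow> 0) at_top"
      using assms z0 by real_asymp
    then have "(F \<longlongrightarrow> 0) at_top"
    proof (rule Lim_null_comparison[rotated], intro eventually_mono[OF eventually_gt_at_top[of 0]])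
      fix k :: real assume k: "k > 0"
      have "cmod (of_real k / z + 1 / z\<^sup>2) \<le> k / cmod z + 1 / cmod z ^ 2"
        using norm_triangle_ineq[of "of_real k / z" "1 / z\<^sup>2"] k by (simp add: norm_divide norm_power)
      moreover have "cmod (exp (- z * of_real k)) = exp (- L * k)"
        by (simp add: norm_exp_eq_Re z_def)
      ultimately show "cmod (F k) \<le> (k / cmod z + 1 / cmod z ^ 2) * exp (- L * k)"
        by (simp add: F_def norm_mult norm_minus_commute[of "- (of_real k / z)"] mult_right_mono del: norm_exp_eq_Re minus_add_distrib)
    qed
    then show "((F \<circ> real_of_ereal) \<longlongrightarrow> 0) (at_left \<infinity>)" by (simp add: ereal_tendsto_simps)
  qed (use int dF in auto)
  then have "(\<integral>k. indicator {0<..} k *\<^sub>R f k \<partial>lborel) = 1 / z\<^sup>2"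
    by (simp add: F_def interval_lebesgue_integral_def set_lebesgue_integral_def zero_ereal_def einterval_def indicator_def greaterThan_def)
  then show ?thesis unfolding eq z_def .
qed

section \<open>Momentum-space decay of smeared derivatives\<close>

lemma borel_measurable_cnj [measurable (raw)]:
  assumes "f \<in> borel_measurable M"
  shows "(\<lambda>x. cnj (f x)) \<in> borel_measurable M"
  by (rule measurable_compose[OF assms]) (intro borel_measurable_continuous_onI continuous_intros)

text \<open>The zero of \<open>P\<close> at the origin cancels the pole of the weight and its decay
  controls large \<open>k\<close>: for positive \<open>k\<close> the weighted product is bounded by
  \<open>C * C' / (1 + k^2)\<close>.\<close>

lemma integrable_dk2k_mult:
  fixes P Q :: "real \<Rightarrow> complex"
  assumes [measurable]: "P \<in> borel_measurable borel" "Q \<in> borel_measurable borel"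
    and P: "\<And>k. cmod (P k) \<le> C * \<bar>k\<bar> / (1 + k\<^sup>2)" and Q: "\<And>k. cmod (Q k) \<le> C'"
  shows "integrable dk2k (\<lambda>k. P k * Q k)"
proof (subst integrable_dk2k_iff)
  show "integrable lborel (\<lambda>k. (indicator {0<..} k / (2 * k)) *\<^sub>R (P k * Q k))"
  proof (rule Bochner_Integration.integrable_bound[OF integrable_inverse_1_plus_square_real[of "C * C'"]], simp, intro AE_I2)
    fix k :: real
    have "0 \<le> C" using order_trans[OF norm_ge_zero P[of 1]] by simp
    moreover have "0 \<le> C'" using order_trans[OF norm_ge_zero Q[of 0]] .
    ultimately have nn: "0 \<le> (C * C') / (1 + k\<^sup>2)" by simp
    show "norm ((indicator {0<..} k / (2 * k)) *\<^sub>R (P k * Q k)) \<le> norm ((C * C') / (1 + k\<^sup>2))"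
    proof (cases "k > 0")
      case True
      have "cmod (P k) * cmod (Q k) \<le> C * \<bar>k\<bar> / (1 + k\<^sup>2) * C'"
        using P[of k] Q[of k] by (intro mult_mono) (auto intro: order_trans[of _ "cmod (P k)"])
      also have "\<dots> = k * ((C * C') / (1 + k\<^sup>2))"
        using True by simp
      also have "\<dots> \<le> 2 * k * ((C * C') / (1 + k\<^sup>2))"
        using True by (intro mult_right_mono nn) simp
      finally have "cmod (P k) * cmod (Q k) / (2 * k) \<le> (C * C') / (1 + k\<^sup>2)"
        using True by (simp add: pos_divide_le_eq mult.commute)
      also have "\<dots> \<le> norm ((C * C') / (1 + k\<^sup>2))"
        unfolding real_norm_def by (rule abs_ge_self)
      finally show ?thesis using True by (simp add: norm_mult)
    qed (use nn in simp)
  qed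
qed simp

section \<open>Modes of test functions under a change of coordinate\<close>

lemma test_fun_smooth: "test_fun f \<Longrightarrow> smooth f"
  by (simp add: test_fun_def)

lemma test_fun_compact: "test_fun f \<Longrightarrow> compact (supp f)"
  by (simp add: test_fun_def)

lemma vderiv_zero_outside: "test_fun f \<Longrightarrow> x \<notin> supp f \<Longrightarrow> vderiv f x = 0"
  by (rule has_vector_derivative_zero_outside[OF _ test_fun_zero smooth_has_vector_derivative[OF test_fun_smooth]])
     (auto simp: supp_def)

text \<open>Positivity of \<open>X'\<close> makes \<open>X\<close> injective, so distinct points
  keep distinct images, and allows division by \<open>X'\<close>; continuity of \<open>X''\<close>
  serves the second integration by parts.\<close>

locale reparametrization =
  fixes X X' X'' :: "real \<Rightarrow> real"
  assumes DX: "(X has_real_derivative X' y) (at y)"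
    and DX': "(X' has_real_derivative X'' y) (at y)"
    and continuous_X'': "continuous_on UNIV X''"
    and X'_pos: "X' y > 0"
begin

lemma continuous_X: "continuous_on A X"
  by (intro continuous_at_imp_continuous_on ballI DERIV_isCont[OF DX])

lemma continuous_X': "continuous_on A X'"
  by (intro continuous_at_imp_continuous_on ballI DERIV_isCont[OF DX'])

lemma X_borel [measurable]: "X \<in> borel_measurable borel"
  by (rule borel_measurable_continuous_onI[OF continuous_X])

lemma X_eq_iff: "X y = X z \<longleftrightarrow> y = z"
proof -
  have "X y < X z" if "y < z" for y z
    by (rule DERIV_pos_imp_increasing[OF that]) (use DX X'_pos in blast)
  then show ?thesis by (metis less_irrefl linorder_neqE)
qed

lemma mode_derivative_compact_support:
  assumes S: "compact S" "\<And>y. y \<notin> S \<Longrightarrow> u y = 0"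
    and u: "\<And>y. (u has_vector_derivative u' y) (at y)" and contu': "continuous_on UNIV u'"
  shows "mode X u' k = \<i> * of_real k * mode X (\<lambda>y. u y * of_real (X' y)) k"
proof (rule mode_derivative[OF DX continuous_X' u contu'])
  have contu: "continuous_on UNIV u"
    by (meson u has_vector_derivative_continuous continuous_at_imp_continuous_on)
  have "u' y = 0" if "y \<notin> S" for y
    by (rule has_vector_derivative_zero_outside[OF _ S(2) u that]) (use S(1) compact_imp_closed in auto)
  then show "integrable lborel u'"
    using integrable_compact_support[OF S(1) continuous_on_subset[OF contu' subset_UNIV]] by blast
  show "integrable lborel (\<lambda>y. u y * of_real (X' y))"
    by (rule integrable_compact_support[OF S(1)])
       (auto simp: S(2) intro!: continuous_intros continuous_on_of_real continuous_X' continuous_on_subset[OF contu])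
  show "(u \<longlongrightarrow> 0) at_top" "(u \<longlongrightarrow> 0) at_bot"
    by (rule tendsto_0_compact_support[OF S]; assumption)+
qed

lemma mode_vderiv:
  assumes "test_fun f"
  shows "mode X (vderiv f) k = \<i> * of_real k * mode X (\<lambda>y. f y * of_real (X' y)) k"
  by (rule mode_derivative_compact_support[OF test_fun_compact[OF assms] test_fun_zero])
     (auto intro!: smooth_has_vector_derivative smooth_continuous_on smooth_vderiv[OF test_fun_smooth[OF assms]]
        test_fun_smooth[OF assms])

text \<open>One integration by parts bounds the mode by \<open>B * \<bar>k\<bar>\<close>, which is
  good near 0; another bounds \<open>\<bar>k\<bar>\<close> times the mode by \<open>A\<close>, which
  is good at infinity. Adding the first to \<open>\<bar>k\<bar>\<close> times the second gives the
  quotient.\<close>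

lemma mode_vderiv_bound:
  assumes f: "test_fun f"
  obtains C where "\<And>k. cmod (mode X (vderiv f) k) \<le> C * \<bar>k\<bar> / (1 + k\<^sup>2)"
proof -
  let ?f' = "vderiv f" and ?f'' = "vderiv (vderiv f)"
  have sm: "smooth f" "smooth ?f'" "smooth ?f''" using f by (auto intro: smooth_vderiv test_fun_smooth)
  \<comment> \<open>Chosen so that \<open>u y * X' y\<close> is \<open>?f' y\<close>: integration by
    parts returns a factor \<open>X'\<close>, which has to be divided out beforehand.\<close>
  define u where "u y = ?f' y * of_real (inverse (X' y))" for y
  define u' where "u' y = ?f' y * of_real (- X'' y / (X' y)\<^sup>2) + ?f'' y * of_real (inverse (X' y))" for y
  have X'0: "X' y \<noteq> 0" for y using X'_pos[of y] by simp
  have u: "(u has_vector_derivative u' y) (at y)" for y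
  proof -
    have "((\<lambda>y. inverse (X' y)) has_real_derivative - X'' y / (X' y)\<^sup>2) (at y)"
      using DX'[of y] X'0 by (auto intro!: derivative_eq_intros simp: divide_inverse power2_eq_square)
    from has_vector_derivative_mult[OF smooth_has_vector_derivative[OF sm(2), of y] has_vector_derivative_of_real[OF this]]
    show ?thesis by (simp add: u_def[abs_def] u'_def)
  qed
  have contu': "continuous_on UNIV u'"
    unfolding u'_def using X'0
    by (intro continuous_intros smooth_continuous_on sm continuous_on_of_real continuous_X' continuous_X'') auto
  have "mode X u' k = \<i> * of_real k * mode X ?f' k" for k
  proof -
    have "(\<lambda>y. u y * of_real (X' y)) = ?f'"
      using X'0 by (simp add: u_def fun_eq_iff mult.assoc flip: of_real_mult)
    moreover have "mode X u' k = \<i> * of_real k * mode X (\<lambda>y. u y * of_real (X' y)) k"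
      by (rule mode_derivative_compact_support[OF test_fun_compact[OF f] _ u contu'])
         (simp add: u_def vderiv_zero_outside[OF f])
    ultimately show ?thesis by simp
  qed
  then have decay: "\<bar>k\<bar> * cmod (mode X ?f' k) = cmod (mode X u' k)" for k
    by (simp add: norm_mult)
  define A where "A = (1 / sqrt (2 * pi)) * (\<integral>y. cmod (u' y) \<partial>lborel)"
  define B where "B = (1 / sqrt (2 * pi)) * (\<integral>y. cmod (f y * of_real (X' y)) \<partial>lborel)"
  have AB: "0 \<le> A" "0 \<le> B" by (simp_all add: A_def B_def)
  have a: "\<bar>k\<bar> * cmod (mode X ?f' k) \<le> A" for k
    unfolding decay A_def by (rule norm_mode_le)
  have b: "cmod (mode X ?f' k) \<le> B * \<bar>k\<bar>" for k
  proof -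
    have "cmod (mode X (\<lambda>y. f y * of_real (X' y)) k) \<le> B" unfolding B_def by (rule norm_mode_le)
    then have "\<bar>k\<bar> * cmod (mode X (\<lambda>y. f y * of_real (X' y)) k) \<le> \<bar>k\<bar> * B" by (rule mult_left_mono) simp
    then show ?thesis by (simp add: mode_vderiv[OF f] norm_mult mult.commute)
  qed
  show thesis
  proof (rule that)
    fix k :: real
    have "(1 + k\<^sup>2) * cmod (mode X ?f' k) = cmod (mode X ?f' k) + \<bar>k\<bar> * (\<bar>k\<bar> * cmod (mode X ?f' k))"
      by (simp add: algebra_simps power2_eq_square flip: abs_mult)
    also have "\<dots> \<le> B * \<bar>k\<bar> + \<bar>k\<bar> * A"
      by (intro add_mono b mult_left_mono a) auto
    finally have "(1 + k\<^sup>2) * cmod (mode X ?f' k) \<le> (A + B) * \<bar>k\<bar>" by (simp add: algebra_simps)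
    moreover have "1 + k\<^sup>2 > 0" by (simp add: add_pos_nonneg)
    ultimately show "cmod (mode X (vderiv f) k) \<le> (A + B) * \<bar>k\<bar> / (1 + k\<^sup>2)"
      by (simp add: pos_le_divide_eq mult.commute)
  qed
qed

lemma mode_vderiv_borel:
  assumes "test_fun f"
  shows "mode X (vderiv f) \<in> borel_measurable borel"
  by (intro borel_measurable_continuous_onI continuous_mode X_borel
      integrable_compact_support[OF test_fun_compact[OF assms] smooth_continuous_on vderiv_zero_outside[OF assms]]
      smooth_vderiv test_fun_smooth assms)

lemma mode_vderiv_bounded:
  assumes "test_fun f" obtains C where "\<And>k. cmod (mode X (vderiv f) k) \<le> C"
  using norm_mode_le that by metis

text \<open>The sign \<open>s\<close> treats both halves of the field at once: 1 is the annihilation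
  part, \<open>- 1\<close> the creation part.\<close>

lemma integrable_mode_vderiv_mult:
  assumes f: "test_fun f" and s: "\<bar>s\<bar> = 1"
    and Q: "Q \<in> borel_measurable borel" "\<And>k. cmod (Q k) \<le> C'"
  shows "integrable dk2k (\<lambda>k. mode X (vderiv f) (s * k) * Q k)"
    and "integrable dk2k (\<lambda>k. cnj (mode X (vderiv f) (s * k)) * Q k)"
proof -
  note [measurable] = mode_vderiv_borel[OF f] Q(1)
  obtain C where C: "\<And>k. cmod (mode X (vderiv f) k) \<le> C * \<bar>k\<bar> / (1 + k\<^sup>2)"
    using mode_vderiv_bound[OF f] by blast
  have s2: "\<bar>s * k\<bar> = \<bar>k\<bar>" "(s * k)\<^sup>2 = k\<^sup>2" for k
  proof -
    have "s = 1 \<or> s = - 1" using s by linarith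
    then show "\<bar>s * k\<bar> = \<bar>k\<bar>" "(s * k)\<^sup>2 = k\<^sup>2" by auto
  qed
  have bd: "cmod (mode X (vderiv f) (s * k)) \<le> C * \<bar>k\<bar> / (1 + k\<^sup>2)" for k
    using C[of "s * k"] unfolding s2 .
  show "integrable dk2k (\<lambda>k. mode X (vderiv f) (s * k) * Q k)"
    by (rule integrable_dk2k_mult[OF _ Q(1) bd Q(2)]) measurable
  show "integrable dk2k (\<lambda>k. cnj (mode X (vderiv f) (s * k)) * Q k)"
    by (rule integrable_dk2k_mult[OF _ Q(1) _ Q(2), where C = C]) (simp_all add: bd)
qed

end

section \<open>Two-point functions\<close>

lemma integrable_lborel_pair_mult:
  fixes u :: "'a::euclidean_space \<Rightarrow> complex" and v :: "'b::euclidean_space \<Rightarrow> complex"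
  assumes u: "integrable lborel u" and v: "integrable lborel v"
  shows "integrable (lborel \<Otimes>\<^sub>M lborel) (\<lambda>p. u (fst p) * v (snd p))"
proof (rule lborel_pair.Fubini_integrable)
  have [measurable]: "u \<in> borel_measurable borel" "v \<in> borel_measurable borel"
    using u v borel_measurable_integrable by auto
  show "(\<lambda>p. u (fst p) * v (snd p)) \<in> borel_measurable (lborel \<Otimes>\<^sub>M lborel)" by measurable
qed (use u v in \<open>auto simp: norm_mult\<close>)

lemma integral_lborel_pair_mult:
  fixes u :: "'a::euclidean_space \<Rightarrow> complex" and v :: "'b::euclidean_space \<Rightarrow> complex"
  assumes u: "integrable lborel u" and v: "integrable lborel v"
  shows "integrable lborel (\<lambda>p. u (fst p) * v (snd p))"
    and "(\<integral>p. u (fst p) * v (snd p) \<partial>lborel) = integral\<^sup>L lborel u * integral\<^sup>L lborel v"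
proof -
  note int = integrable_lborel_pair_mult[OF u v]
  then show "integrable lborel (\<lambda>p. u (fst p) * v (snd p))" by (simp add: lborel_prod)
  show "(\<integral>p. u (fst p) * v (snd p) \<partial>lborel) = integral\<^sup>L lborel u * integral\<^sup>L lborel v"
    using lborel_pair.integral_fst'[OF int] by (simp add: lborel_prod)
qed

lemma integrable_lborel_pair_mult_exp:
  fixes u :: "real \<Rightarrow> complex" and v :: "'b::euclidean_space \<Rightarrow> complex"
  assumes u: "integrable lborel u" and v: "integrable lborel v" and [measurable]: "D \<in> borel_measurable borel"
  shows "integrable (lborel \<Otimes>\<^sub>M lborel) (\<lambda>(k, y). u k * v y * exp (- \<i> * of_real (k * D y)))"
proof -
  have [measurable]: "u \<in> borel_measurable borel" "v \<in> borel_measurable borel"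
    using u v borel_measurable_integrable by auto
  show ?thesis
    by (rule Bochner_Integration.integrable_bound[OF integrable_lborel_pair_mult[OF u v]])
       (auto simp: norm_mult case_prod_unfold)
qed

text \<open>Damping gives \<open>k\<close> an integrable weight, so Fubini applies to momentum and
  position jointly; the inner integral is then the Laplace transform
  \<open>integral_exp_times\<close>.\<close>

lemma two_point_integral_damped:
  fixes aa :: "real \<times> real \<Rightarrow> complex" and D :: "real \<times> real \<Rightarrow> real"
  assumes aa: "integrable lborel aa" and D: "D \<in> borel_measurable borel" and L: "L > 0"
  shows "(\<integral>k. of_real (indicator {0<..} k * (k * exp (- L * k))) * (\<integral>p. aa p * exp (- \<i> * of_real (k * D p)) \<partial>lborel) \<partial>lborel)
     = (\<integral>p. aa p / (of_real L + \<i> * of_real (D p))\<^sup>2 \<partial>lborel)"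
proof -
  let ?c = "\<lambda>k. complex_of_real (indicator {0<..} k * (k * exp (- L * k)))"
  have c: "integrable lborel ?c"
    using integrable_exp_times[OF L] by (rule integrable_of_real)
  have "(\<integral>k. ?c k * (\<integral>p. aa p * exp (- \<i> * of_real (k * D p)) \<partial>lborel) \<partial>lborel)
      = (\<integral>k. (\<integral>p. ?c k * aa p * exp (- \<i> * of_real (k * D p)) \<partial>lborel) \<partial>lborel)"
    by (simp only: integral_mult_right_zero[symmetric] mult.assoc)
  also have "\<dots> = (\<integral>p. (\<integral>k. ?c k * aa p * exp (- \<i> * of_real (k * D p)) \<partial>lborel) \<partial>lborel)"
    by (rule lborel_pair.Fubini_integral[symmetric]) (rule integrable_lborel_pair_mult_exp[OF c aa D])
  also have "\<dots> = (\<integral>p. aa p * (\<integral>k. ?c k * exp (- \<i> * of_real (k * D p)) \<partial>lborel) \<partial>lborel)"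
    by (simp only: integral_mult_right_zero[symmetric] mult_ac)
  also have "\<dots> = (\<integral>p. aa p / (of_real L + \<i> * of_real (D p))\<^sup>2 \<partial>lborel)"
    unfolding integral_exp_times[OF L] by simp
  finally show ?thesis .
qed

text \<open>The mixed derivative in \<open>y\<close> and \<open>z\<close> of the logarithmic kernel
  \<open>- ln \<bar>X y - X z\<bar> / (4 * pi)\<close>.\<close>

definition vacuum_correlation :: "(real \<Rightarrow> real) \<Rightarrow> (real \<Rightarrow> real) \<Rightarrow> real \<Rightarrow> real \<Rightarrow> complex" where
  "vacuum_correlation X X' y z = of_real (- (X' y * X' z) / (4 * pi * (X y - X z)\<^sup>2))"

context reparametrization begin

text \<open>The supports are compact and disjoint and \<open>X\<close> is injective, so the distance
  of images attains a positive minimum; if a support is empty, any \<open>\<delta>\<close> will do.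
  This gap controls the kernel uniformly once the damping is removed.\<close>

lemma separation:
  assumes "test_fun f" "test_fun h" "supp f \<inter> supp h = {}"
  obtains \<delta> where "\<delta> > 0" "\<And>y z. y \<in> supp f \<Longrightarrow> z \<in> supp h \<Longrightarrow> \<delta> \<le> \<bar>X y - X z\<bar>"
proof (cases "supp f \<times> supp h = {}")
  case False
  have "compact (supp f \<times> supp h)"
    using assms by (intro compact_Times test_fun_compact)
  moreover have "continuous_on (supp f \<times> supp h) (\<lambda>p. \<bar>X (fst p) - X (snd p)\<bar>)"
    by (intro continuous_intros continuous_on_compose2[OF continuous_X[of UNIV]]) auto
  ultimately obtain p where p: "p \<in> supp f \<times> supp h"
    "\<And>q. q \<in> supp f \<times> supp h \<Longrightarrow> \<bar>X (fst p) - X (snd p)\<bar> \<le> \<bar>X (fst q) - X (snd q)\<bar>"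
    using continuous_attains_inf[OF _ False, of "\<lambda>p. \<bar>X (fst p) - X (snd p)\<bar>"] by blast
  have "fst p \<noteq> snd p" using p(1) assms(3) by auto
  then have "\<bar>X (fst p) - X (snd p)\<bar> > 0" by (simp add: X_eq_iff)
  then show thesis using p(2) by (intro that[of "\<bar>X (fst p) - X (snd p)\<bar>"]) auto
next
  case True
  then show thesis by (intro that[of 1]) auto
qed

lemma integrable_mode_vderiv_product:
  assumes f: "test_fun f" and h: "test_fun h"
  shows "integrable dk2k (\<lambda>k. cnj (mode X (vderiv f) (- k)) * mode X (vderiv h) (- k))"
proof -
  obtain C where C: "\<And>k. cmod (mode X (vderiv h) k) \<le> C" using mode_vderiv_bounded[OF h] by blast
  have [measurable]: "mode X (vderiv h) \<in> borel_measurable borel" by (rule mode_vderiv_borel[OF h])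
  show ?thesis
    using integrable_mode_vderiv_mult(2)[OF f, of "-1" "\<lambda>k. mode X (vderiv h) (- k)" C] C by simp
qed

text \<open>Both sides are limits of the same damped integral. On the momentum side the undamped
  integrand is integrable by the decay of the modes and serves as its own majorant; on the position
  side the gap between the supports gives the majorant.\<close>

lemma vacuum_two_point:
  assumes f: "test_fun f" and h: "test_fun h" and disj: "supp f \<inter> supp h = {}"
  shows "integrable lborel (\<lambda>p. cnj (f (fst p)) * h (snd p) * vacuum_correlation X X' (fst p) (snd p))"
    and "(\<integral>k. cnj (mode X (vderiv f) (- k)) * mode X (vderiv h) (- k) \<partial>dk2k)
       = (\<integral>p. cnj (f (fst p)) * h (snd p) * vacuum_correlation X X' (fst p) (snd p) \<partial>lborel)"
proof -
  define a where "a y = cnj (f y) * of_real (X' y)" for y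
  define b where "b y = h y * of_real (X' y)" for y
  define aa where "aa p = a (fst p) * b (snd p)" for p
  define D where "D p = X (fst p) - X (snd p)" for p
  have [measurable]: "D \<in> borel_measurable borel" unfolding D_def borel_prod[symmetric] by measurable
  note cont = smooth_continuous_on[OF test_fun_smooth[OF f]] smooth_continuous_on[OF test_fun_smooth[OF h]]
  have a: "integrable lborel a"
    by (rule integrable_compact_support[OF test_fun_compact[OF f]])
       (auto simp: a_def test_fun_zero intro!: continuous_intros cont continuous_on_of_real continuous_X')
  have b: "integrable lborel b"
    by (rule integrable_compact_support[OF test_fun_compact[OF h]])
       (auto simp: b_def test_fun_zero intro!: continuous_intros cont continuous_on_of_real continuous_X')
  have aa: "integrable lborel aa" unfolding aa_def by (rule integral_lborel_pair_mult[OF a b])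
  then have [measurable]: "aa \<in> borel_measurable borel"
    using borel_measurable_integrable by auto
  obtain \<delta> where \<delta>: "\<delta> > 0" "\<And>y z. y \<in> supp f \<Longrightarrow> z \<in> supp h \<Longrightarrow> \<delta> \<le> \<bar>X y - X z\<bar>"
    using separation[OF f h disj] by blast
  have sep: "\<delta> \<le> \<bar>D p\<bar>" if "aa p \<noteq> 0" for p
  proof -
    have "fst p \<in> supp f" "snd p \<in> supp h"
      using that test_fun_zero[of "fst p" f] test_fun_zero[of "snd p" h] by (auto simp: aa_def a_def b_def)
    then show ?thesis using \<delta>(2) by (simp add: D_def)
  qed
  \<comment> \<open>The minus sign of the kernel is absorbed into
    \<open>(\<i> * D)^2 = - D^2\<close>, the form reached as the damping tends to 0.\<close>
  have eq: "cnj (f (fst p)) * h (snd p) * vacuum_correlation X X' (fst p) (snd p)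
      = of_real (1 / (4 * pi)) * (aa p / (\<i> * of_real (D p))\<^sup>2)" for p
    by (simp add: vacuum_correlation_def aa_def a_def b_def D_def power_mult_distrib)
  \<comment> \<open>Where \<open>aa\<close> is nonzero, the imaginary part alone has modulus at
    least \<open>\<delta>\<close>, so the bound does not depend on \<open>L\<close>.\<close>
  have bound: "cmod (aa p / (of_real L + \<i> * of_real (D p))\<^sup>2) \<le> cmod (aa p) / \<delta>\<^sup>2" for p L
  proof (cases "aa p = 0")
    case False
    have "\<delta> \<le> cmod (of_real L + \<i> * of_real (D p))"
      using sep[OF False] abs_Im_le_cmod[of "of_real L + \<i> * of_real (D p)"] by simp
    then have "\<delta>\<^sup>2 \<le> cmod (of_real L + \<i> * of_real (D p)) ^ 2"
      using \<delta>(1) by (intro power_mono) auto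
    moreover have "\<delta>\<^sup>2 > 0" using \<delta>(1) by simp
    ultimately show ?thesis
      unfolding norm_divide norm_power by (intro divide_left_mono mult_pos_pos) auto
  qed simp
  have int: "integrable lborel (\<lambda>p. cmod (aa p) / \<delta>\<^sup>2)" using aa by simp
  have "integrable lborel (\<lambda>p. aa p / (\<i> * of_real (D p))\<^sup>2)"
    by (rule Bochner_Integration.integrable_bound[OF int]) (use bound[of _ 0] in auto)
  then show "integrable lborel (\<lambda>p. cnj (f (fst p)) * h (snd p) * vacuum_correlation X X' (fst p) (snd p))"
    unfolding eq by (rule integrable_mult_right)

  define \<Phi> where "\<Phi> k = (indicator {0<..} k / (2 * k)) *\<^sub>R (cnj (mode X (vderiv f) (- k)) * mode X (vderiv h) (- k))" for k
  \<comment> \<open>The two derivatives contribute \<open>k^2\<close>, the weight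
    \<open>1 / (2 * k)\<close>, and the two Fourier constants \<open>1 / (2 * pi)\<close>; together
    this is \<open>k / (4 * pi)\<close>.\<close>
  have \<Phi>: "\<Phi> k = of_real (1 / (4 * pi)) * (of_real (indicator {0<..} k * k) * (\<integral>p. aa p * exp (- \<i> * of_real (k * D p)) \<partial>lborel))" for k
  proof -
    let ?A = "\<integral>y. a y * exp (- \<i> * of_real (k * X y)) \<partial>lborel" and ?B = "\<integral>y. b y * exp (- \<i> * of_real (- k * X y)) \<partial>lborel"
    have AB: "?A * ?B = (\<integral>p. aa p * exp (- \<i> * of_real (k * D p)) \<partial>lborel)"
    proof -
      have "?A * ?B = (\<integral>p. (a (fst p) * exp (- \<i> * of_real (k * X (fst p)))) * (b (snd p) * exp (- \<i> * of_real (- k * X (snd p)))) \<partial>lborel)"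
        by (rule integral_lborel_pair_mult(2)[symmetric]; rule integrable_mult_exp; (rule a b X_borel))
      also have "\<dots> = (\<integral>p. aa p * exp (- \<i> * of_real (k * D p)) \<partial>lborel)"
        by (intro Bochner_Integration.integral_cong refl)
           (simp add: aa_def D_def algebra_simps exp_diff exp_minus divide_simps exp_add)
      finally show ?thesis .
    qed
    have "cnj (mode X (\<lambda>y. f y * of_real (X' y)) (- k)) = mode X a k"
      by (simp add: mode_cnj[symmetric] a_def[abs_def])
    moreover have "cnj (\<i> * of_real (- k) * M) * (\<i> * of_real (- k) * N) = of_real (k\<^sup>2) * (cnj M * N)" for M N
      by (simp add: complex_eq_iff power2_eq_square algebra_simps)
    ultimately have "cnj (mode X (vderiv f) (- k)) * mode X (vderiv h) (- k) = of_real (k\<^sup>2) * (mode X a k * mode X b (- k))"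
      unfolding mode_vderiv[OF f] mode_vderiv[OF h] b_def[abs_def] by (simp only:)
    also have "mode X a k * mode X b (- k) = of_real ((1 / sqrt (2 * pi)) * (1 / sqrt (2 * pi))) * (?A * ?B)"
      by (simp only: mode_def of_real_mult mult_ac)
    also have "(1 / sqrt (2 * pi)) * (1 / sqrt (2 * pi)) = 1 / (2 * pi)" by simp
    finally have "cnj (mode X (vderiv f) (- k)) * mode X (vderiv h) (- k) = of_real (k\<^sup>2) * (of_real (1 / (2 * pi)) * (?A * ?B))" .
    from this[unfolded AB] show ?thesis unfolding \<Phi>_def
      by (cases "k > 0") (simp_all add: scaleR_conv_of_real power2_eq_square)
  qed
  note int0 = integrable_mode_vderiv_product[OF f h]
  have meas [measurable]: "(\<lambda>k. cnj (mode X (vderiv f) (- k)) * mode X (vderiv h) (- k)) \<in> borel_measurable borel"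
    using borel_measurable_integrable[OF int0] by (simp cong: measurable_cong_sets)
  have \<Phi>int: "integrable lborel \<Phi>"
    unfolding \<Phi>_def using int0 by (subst (asm) integrable_dk2k_iff[OF meas])
  have I: "(\<integral>k. cnj (mode X (vderiv f) (- k)) * mode X (vderiv h) (- k) \<partial>dk2k) = integral\<^sup>L lborel \<Phi>"
    unfolding \<Phi>_def by (rule integral_dk2k_eq[OF meas])

  define L where "L n = inverse (real (Suc n))" for n
  have L: "L n > 0" for n by (simp add: L_def)
  have Llim: "L \<longlonglongrightarrow> 0" unfolding L_def by (rule LIMSEQ_inverse_real_of_nat)
  have damped: "(\<integral>k. of_real (exp (- L n * k)) * \<Phi> k \<partial>lborel)
       = of_real (1 / (4 * pi)) * (\<integral>p. aa p / (of_real (L n) + \<i> * of_real (D p))\<^sup>2 \<partial>lborel)" for n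
  proof -
    have "of_real (exp (- L n * k)) * \<Phi> k = of_real (1 / (4 * pi)) * (of_real (indicator {0<..} k * (k * exp (- L n * k)))
         * (\<integral>p. aa p * exp (- \<i> * of_real (k * D p)) \<partial>lborel))" for k
      unfolding \<Phi> by (simp add: mult_ac)
    then show ?thesis
      by (simp only: integral_mult_right_zero) (simp only: two_point_integral_damped[OF aa \<open>D \<in> borel_measurable borel\<close> L])
  qed
  have "(\<lambda>n. \<integral>k. of_real (exp (- L n * k)) * \<Phi> k \<partial>lborel) \<longlonglongrightarrow> integral\<^sup>L lborel \<Phi>"
  proof (rule integral_dominated_convergence[where w = "\<lambda>k. norm (\<Phi> k)"])
    have \<Phi>m [measurable]: "\<Phi> \<in> borel_measurable borel" using \<Phi>int borel_measurable_integrable by auto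
    show "\<Phi> \<in> borel_measurable lborel" by simp
    show "(\<lambda>k. of_real (exp (- L n * k)) * \<Phi> k) \<in> borel_measurable lborel" for n by measurable
    show "AE k in lborel. (\<lambda>n. of_real (exp (- L n * k)) * \<Phi> k) \<longlonglongrightarrow> \<Phi> k"
    proof (intro AE_I2)
      fix k :: real
      have "(\<lambda>n. of_real (exp (- L n * k)) * \<Phi> k) \<longlonglongrightarrow> of_real (exp (- 0 * k)) * \<Phi> k"
        by (intro tendsto_intros Llim)
      then show "(\<lambda>n. of_real (exp (- L n * k)) * \<Phi> k) \<longlonglongrightarrow> \<Phi> k" by simp
    qed
    show "AE k in lborel. norm (of_real (exp (- L n * k)) * \<Phi> k) \<le> norm (\<Phi> k)" for n
    proof (intro AE_I2)
      fix k :: real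
      show "norm (of_real (exp (- L n * k)) * \<Phi> k) \<le> norm (\<Phi> k)"
      proof (cases "k > 0")
        case True
        then have "exp (- L n * k) \<le> 1" using L[of n] by simp
        then show ?thesis by (simp add: norm_mult mult_left_le_one_le)
      qed (simp add: \<Phi>_def)
    qed
  qed (use \<Phi>int in auto)
  moreover have "(\<lambda>n. \<integral>k. of_real (exp (- L n * k)) * \<Phi> k \<partial>lborel)
     \<longlonglongrightarrow> of_real (1 / (4 * pi)) * (\<integral>p. aa p / (\<i> * of_real (D p))\<^sup>2 \<partial>lborel)"
    unfolding damped
  proof (intro tendsto_mult tendsto_const integral_dominated_convergence[where w = "\<lambda>p. cmod (aa p) / \<delta>\<^sup>2"])
    show "AE p in lborel. (\<lambda>n. aa p / (of_real (L n) + \<i> * of_real (D p))\<^sup>2) \<longlonglongrightarrow> aa p / (\<i> * of_real (D p))\<^sup>2"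
    proof (intro AE_I2)
      fix p
      show "(\<lambda>n. aa p / (of_real (L n) + \<i> * of_real (D p))\<^sup>2) \<longlonglongrightarrow> aa p / (\<i> * of_real (D p))\<^sup>2"
      proof (cases "aa p = 0")
        case False
        then have "D p \<noteq> 0" using sep[OF False] \<delta>(1) by auto
        then have "(\<lambda>n. aa p / (of_real (L n) + \<i> * of_real (D p))\<^sup>2) \<longlonglongrightarrow> aa p / (of_real 0 + \<i> * of_real (D p))\<^sup>2"
          by (intro tendsto_intros Llim) auto
        then show ?thesis by simp
      qed simp
    qed
    show "AE p in lborel. cmod (aa p / (of_real (L n) + \<i> * of_real (D p))\<^sup>2) \<le> cmod (aa p) / \<delta>\<^sup>2" for n
      using bound by simp
  qed (use int in auto)
  ultimately have "integral\<^sup>L lborel \<Phi> = of_real (1 / (4 * pi)) * (\<integral>p. aa p / (\<i> * of_real (D p))\<^sup>2 \<partial>lborel)"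
    by (rule LIMSEQ_unique)
  then show "(\<integral>k. cnj (mode X (vderiv f) (- k)) * mode X (vderiv h) (- k) \<partial>dk2k)
       = (\<integral>p. cnj (f (fst p)) * h (snd p) * vacuum_correlation X X' (fst p) (snd p) \<partial>lborel)"
    unfolding eq I by (simp only: integral_mult_right_zero)
qed

text \<open>The factor \<open>k\<close> from the derivative cancels the \<open>k\<close> of the
  weight and leaves \<open>s / 2\<close>. As \<open>\<Gamma>\<close> vanishes for
  \<open>k \<le> 0\<close>, the half-line integral is a full Fourier integral, which Fubini
  exchanges with the smearing.\<close>

lemma mode_vderiv_overlap:
  assumes h: "test_fun h" and s: "\<bar>s\<bar> = 1" and \<Gamma>: "integrable lborel \<Gamma>" and \<Gamma>0: "\<And>k. k \<le> 0 \<Longrightarrow> \<Gamma> k = 0"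
  shows "(\<integral>k. mode X (vderiv h) (s * k) * \<Gamma> k \<partial>dk2k)
     = (\<integral>y. h y * (\<i> * of_real (s / 2) * of_real (X' y) * fourier \<Gamma> (s * X y)) \<partial>lborel)"
proof -
  define b where "b y = h y * of_real (X' y)" for y
  have b: "integrable lborel b"
    by (rule integrable_compact_support[OF test_fun_compact[OF h]])
       (auto simp: b_def test_fun_zero intro!: continuous_intros smooth_continuous_on[OF test_fun_smooth[OF h]]
          continuous_on_of_real continuous_X')
  have [measurable]: "\<Gamma> \<in> borel_measurable borel" using \<Gamma> borel_measurable_integrable by auto
  have [measurable]: "mode X (vderiv h) \<in> borel_measurable borel" by (rule mode_vderiv_borel[OF h])
  let ?c = "complex_of_real (1 / sqrt (2 * pi))" and ?s = "\<i> * complex_of_real (s / 2)"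
  have "(\<integral>k. mode X (vderiv h) (s * k) * \<Gamma> k \<partial>dk2k)
      = (\<integral>k. (indicator {0<..} k / (2 * k)) *\<^sub>R (mode X (vderiv h) (s * k) * \<Gamma> k) \<partial>lborel)"
    by (rule integral_dk2k_eq) measurable
  also have "\<dots> = (\<integral>k. ?s * ?c * (\<integral>y. \<Gamma> k * b y * exp (- \<i> * of_real (k * (s * X y))) \<partial>lborel) \<partial>lborel)"
  proof (intro Bochner_Integration.integral_cong refl)
    fix k :: real
    show "(indicator {0<..} k / (2 * k)) *\<^sub>R (mode X (vderiv h) (s * k) * \<Gamma> k)
       = ?s * ?c * (\<integral>y. \<Gamma> k * b y * exp (- \<i> * of_real (k * (s * X y))) \<partial>lborel)"
    proof (cases "k > 0")
      case True
      have "(\<integral>y. \<Gamma> k * b y * exp (- \<i> * of_real (k * (s * X y))) \<partial>lborel) = \<Gamma> k * (\<integral>y. b y * exp (- \<i> * of_real ((s * k) * X y)) \<partial>lborel)"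
        by (simp add: mult_ac)
      moreover have "mode X (vderiv h) (s * k) = \<i> * of_real (s * k) * (?c * (\<integral>y. b y * exp (- \<i> * of_real ((s * k) * X y)) \<partial>lborel))"
        unfolding mode_vderiv[OF h] unfolding mode_def b_def ..
      ultimately show ?thesis using True
        by (simp add: scaleR_conv_of_real)
    qed (simp add: \<Gamma>0)
  qed
  also have "\<dots> = ?s * ?c * (\<integral>k. (\<integral>y. \<Gamma> k * b y * exp (- \<i> * of_real (k * (s * X y))) \<partial>lborel) \<partial>lborel)"
    by simp
  also have "(\<integral>k. (\<integral>y. \<Gamma> k * b y * exp (- \<i> * of_real (k * (s * X y))) \<partial>lborel) \<partial>lborel)
      = (\<integral>y. (\<integral>k. \<Gamma> k * b y * exp (- \<i> * of_real (k * (s * X y))) \<partial>lborel) \<partial>lborel)"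
    by (rule lborel_pair.Fubini_integral[symmetric]) (rule integrable_lborel_pair_mult_exp[OF \<Gamma> b], measurable)
  also have "?s * ?c * \<dots> = (\<integral>y. ?s * ?c * (\<integral>k. \<Gamma> k * b y * exp (- \<i> * of_real (k * (s * X y))) \<partial>lborel) \<partial>lborel)"
    by simp
  also have "\<dots> = (\<integral>y. h y * (\<i> * of_real (s / 2) * of_real (X' y) * fourier \<Gamma> (s * X y)) \<partial>lborel)"
  proof (intro Bochner_Integration.integral_cong refl)
    fix y
    have "(\<integral>k. \<Gamma> k * b y * exp (- \<i> * of_real (k * (s * X y))) \<partial>lborel) = (\<integral>k. b y * (\<Gamma> k * exp (- \<i> * of_real (s * X y * k))) \<partial>lborel)"
      by (simp only: mult_ac)
    also have "\<dots> = b y * (\<integral>k. \<Gamma> k * exp (- \<i> * of_real (s * X y * k)) \<partial>lborel)" by simp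
    finally show "?s * ?c * (\<integral>k. \<Gamma> k * b y * exp (- \<i> * of_real (k * (s * X y))) \<partial>lborel)
        = h y * (\<i> * of_real (s / 2) * of_real (X' y) * fourier \<Gamma> (s * X y))"
      by (simp only: fourier_def b_def mult_ac)
  qed
  finally show ?thesis .
qed

end

section \<open>Fourier transforms of Schwartz functions\<close>

lemma integrable_inverse_square_decay:
  fixes u :: "real \<Rightarrow> complex"
  assumes "continuous_on UNIV u" "\<And>x. cmod (u x) \<le> C / (1 + x\<^sup>2)"
  shows "integrable lborel u"
proof (rule Bochner_Integration.integrable_bound[OF integrable_inverse_1_plus_square_real[of C]])
  show "AE x in lborel. cmod (u x) \<le> norm (C / (1 + x\<^sup>2))"
    by (intro AE_I2) (metis assms(2) abs_ge_self order_trans real_norm_def)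
qed (use borel_measurable_continuous_onI[OF assms(1)] in simp)

lemma tendsto_0_inverse_square_decay:
  fixes u :: "real \<Rightarrow> complex"
  assumes "\<And>x. cmod (u x) \<le> C / (1 + x\<^sup>2)"
  shows "(u \<longlongrightarrow> 0) at_top" "(u \<longlongrightarrow> 0) at_bot"
proof -
  have "((\<lambda>x::real. C / (1 + x\<^sup>2)) \<longlongrightarrow> 0) at_top"
    "((\<lambda>x::real. C / (1 + x\<^sup>2)) \<longlongrightarrow> 0) at_bot"
    by real_asymp+
  then show "(u \<longlongrightarrow> 0) at_top" "(u \<longlongrightarrow> 0) at_bot"
    using assms Lim_null_comparison[OF always_eventually, of u "\<lambda>x. C / (1 + x\<^sup>2)"] by blast+
qed

lemma inverse_square_decayI:
  assumes "cmod w \<le> A" "x\<^sup>2 * cmod w \<le> B"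
  shows "cmod w \<le> (A + B) / (1 + x\<^sup>2)"
proof -
  have "cmod w * (1 + x\<^sup>2) \<le> A + B" using assms by (simp add: algebra_simps)
  then show ?thesis by (simp add: pos_le_divide_eq add_pos_nonneg)
qed

text \<open>The Schwartz seminorms with \<open>m = 0\<close> and \<open>m = 2\<close> combine into
  one integrable bound.\<close>

lemma schwartz_decay:
  assumes "schwartz g"
  obtains C where "\<And>x. cmod ((vderiv ^^ n) g x) \<le> C / (1 + x\<^sup>2)"
proof -
  have b: "bounded (range (\<lambda>x. x ^ m *\<^sub>R (vderiv ^^ n) g x))" for m
    using assms by (simp add: schwartz_def)
  obtain A where A: "\<And>x. cmod (x ^ 0 *\<^sub>R (vderiv ^^ n) g x) \<le> A" using b[of 0] unfolding bounded_iff by blast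
  obtain B where B: "\<And>x. cmod (x ^ 2 *\<^sub>R (vderiv ^^ n) g x) \<le> B" using b[of 2] unfolding bounded_iff by blast
  show thesis
    by (rule that, rule inverse_square_decayI) (use A B in \<open>simp_all\<close>)
qed

lemma smooth_schwartz: "schwartz g \<Longrightarrow> smooth g"
  by (simp add: schwartz_def)

lemma integrable_schwartz: "schwartz g \<Longrightarrow> integrable lborel g"
  using schwartz_decay[of g 0] integrable_inverse_square_decay[of g] smooth_continuous_on[OF smooth_schwartz]
  by (metis funpow_0)

lemma schwartz_vderiv: "schwartz g \<Longrightarrow> schwartz (vderiv g)"
  unfolding schwartz_def
  by (metis smooth_vderiv funpow_swap1 funpow.simps(2) comp_apply)

lemma fourier_vderiv:
  assumes "schwartz g"
  shows "fourier (vderiv g) k = \<i> * of_real k * fourier g k"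
proof -
  obtain C where C: "\<And>x. cmod ((vderiv ^^ 0) g x) \<le> C / (1 + x\<^sup>2)" using schwartz_decay[OF assms] by blast
  have "mode (\<lambda>x. x) (vderiv g) k = \<i> * of_real k * mode (\<lambda>x. x) (\<lambda>y. g y * of_real 1) k"
    by (rule mode_derivative)
       (use assms C in \<open>auto intro!: smooth_has_vector_derivative smooth_continuous_on smooth_schwartz integrable_schwartz
          schwartz_vderiv tendsto_0_inverse_square_decay[of _ C]\<close>)
  then show ?thesis by (simp add: mode_id)
qed

lemma continuous_fourier: "integrable lborel g \<Longrightarrow> continuous_on UNIV (fourier g)"
  using continuous_mode[of g "\<lambda>x. x"] by (simp add: mode_id)

lemma fourier_bounded: obtains C where "\<And>k. cmod (fourier g k) \<le> C"
  using norm_mode_le[of "\<lambda>x. x" g] by (metis mode_id)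

text \<open>Two derivatives of \<open>g\<close> turn into a factor \<open>k^2\<close> on the Fourier
  side. Quadratic decay is enough for \<open>fourier g\<close> to be integrable and hence to be
  transformed a second time.\<close>

lemma fourier_decay:
  assumes g: "schwartz g"
  obtains C where "\<And>k. cmod (fourier g k) \<le> C / (1 + k\<^sup>2)"
proof -
  obtain A where A: "\<And>k. cmod (fourier g k) \<le> A" by (rule fourier_bounded) (rule that)
  obtain B where B: "\<And>k. cmod (fourier (vderiv (vderiv g)) k) \<le> B" by (rule fourier_bounded) (rule that)
  have "k\<^sup>2 * cmod (fourier g k) \<le> B" for k
    using B[of k] by (simp add: fourier_vderiv g schwartz_vderiv norm_mult power2_eq_square mult.assoc[symmetric] flip: abs_mult)
  then show thesis using A by (intro that[of "A + B"] inverse_square_decayI)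
qed

text \<open>Riemann-Lebesgue: shifting \<open>k\<close> by \<open>\<pi> / x\<close> flips the sign of the exponential.\<close>

lemma fourier_tendsto_0:
  assumes cont: "continuous_on UNIV \<Gamma>" and decay: "\<And>k. cmod (\<Gamma> k) \<le> C / (1 + k\<^sup>2)"
  shows "(fourier \<Gamma> \<longlongrightarrow> 0) at_top"
proof -
  have int: "integrable lborel \<Gamma>" by (rule integrable_inverse_square_decay[OF cont decay])
  have [measurable]: "\<Gamma> \<in> borel_measurable borel" by (rule borel_measurable_continuous_onI[OF cont])
  have C: "C \<ge> 0" using order_trans[OF norm_ge_zero decay[of 0]] by simp
  have shift: "integrable lborel (\<lambda>k. \<Gamma> (k + t))" for t
    using lborel_integrable_real_affine[OF int, of 1 t] by (simp add: add.commute)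
  define R where "R x = (\<integral>k. cmod (\<Gamma> k - \<Gamma> (k + pi / x)) \<partial>lborel)" for x
  have le: "cmod (fourier \<Gamma> x) \<le> (1 / sqrt (2 * pi)) / 2 * R x" if x: "x > 0" for x
  proof -
    let ?J = "\<integral>k. \<Gamma> k * exp (- \<i> * of_real (x * k)) \<partial>lborel"
    have "?J = (\<integral>k. \<Gamma> (k + pi / x) * exp (- \<i> * of_real (x * (k + pi / x))) \<partial>lborel)"
      using lborel_integral_real_affine[of 1 "\<lambda>k. \<Gamma> k * exp (- \<i> * of_real (x * k))" "pi / x"] by (simp add: add.commute)
    also have "\<dots> = (\<integral>k. - (\<Gamma> (k + pi / x) * exp (- \<i> * of_real (x * k))) \<partial>lborel)"
    proof (intro Bochner_Integration.integral_cong refl)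
      fix k
      have "- \<i> * complex_of_real (x * (k + pi / x)) = - \<i> * of_real (x * k) - \<i> * of_real pi"
        using x by (simp add: algebra_simps)
      then show "\<Gamma> (k + pi / x) * exp (- \<i> * of_real (x * (k + pi / x))) = - (\<Gamma> (k + pi / x) * exp (- \<i> * of_real (x * k)))"
        by (simp only: exp_diff exp_pi_i') simp
    qed
    finally have J: "?J = (\<integral>k. - (\<Gamma> (k + pi / x) * exp (- \<i> * of_real (x * k))) \<partial>lborel)" .
    have "2 * ?J = ?J + ?J" by (rule mult_2)
    also have "\<dots> = ?J + (\<integral>k. - (\<Gamma> (k + pi / x) * exp (- \<i> * of_real (x * k))) \<partial>lborel)"
      by (rule arg_cong[OF J])
    also have "\<dots> = (\<integral>k. (\<Gamma> k - \<Gamma> (k + pi / x)) * exp (- \<i> * of_real (x * k)) \<partial>lborel)"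
      using integrable_mult_exp[OF int, of "\<lambda>x. x" x] integrable_mult_exp[OF shift, of "\<lambda>x. x" "pi / x" x]
      by (simp add: left_diff_distrib)
    finally have J2: "2 * ?J = (\<integral>k. (\<Gamma> k - \<Gamma> (k + pi / x)) * exp (- \<i> * of_real (x * k)) \<partial>lborel)" .
    have "2 * cmod ?J = cmod (2 * ?J)" by (simp only: norm_mult norm_numeral)
    also have "\<dots> = cmod (\<integral>k. (\<Gamma> k - \<Gamma> (k + pi / x)) * exp (- \<i> * of_real (x * k)) \<partial>lborel)"
      by (simp only: J2)
    also have "\<dots> \<le> (\<integral>k. cmod ((\<Gamma> k - \<Gamma> (k + pi / x)) * exp (- \<i> * of_real (x * k))) \<partial>lborel)"
      by (rule integral_norm_bound)
    also have "\<dots> = R x" by (simp add: R_def norm_mult)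
    finally have "cmod ?J \<le> R x / 2" by simp
    then have "(1 / sqrt (2 * pi)) * cmod ?J \<le> (1 / sqrt (2 * pi)) * (R x / 2)"
      by (rule mult_left_mono) simp
    then show ?thesis by (simp add: fourier_def norm_mult norm_divide)
  qed
  have "(R \<longlongrightarrow> (\<integral>k. 0 \<partial>(lborel :: real measure))) at_top"
    unfolding R_def
  proof (rule integral_dominated_convergence_at_top[where w = "\<lambda>k. 4 * C / (1 + k\<^sup>2)"])
    show "integrable lborel (\<lambda>k::real. 4 * C / (1 + k\<^sup>2))" by (rule integrable_inverse_1_plus_square_real)
    show "AE k in lborel. ((\<lambda>x. cmod (\<Gamma> k - \<Gamma> (k + pi / x))) \<longlongrightarrow> 0) at_top"
    proof (intro AE_I2)
      fix k
      have "((\<lambda>x. k + pi / x) \<longlongrightarrow> k) at_top" by real_asymp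
      moreover have "isCont \<Gamma> k" using cont by (simp add: continuous_on_eq_continuous_at)
      ultimately have "((\<lambda>x. \<Gamma> (k + pi / x)) \<longlongrightarrow> \<Gamma> k) at_top"
        by (rule isCont_tendsto_compose[rotated])
      from tendsto_norm[OF tendsto_diff[OF tendsto_const[of "\<Gamma> k"] this]]
      show "((\<lambda>x. cmod (\<Gamma> k - \<Gamma> (k + pi / x))) \<longlongrightarrow> 0) at_top" by simp
    qed
    show "\<forall>\<^sub>F x in at_top. AE k in lborel. norm (cmod (\<Gamma> k - \<Gamma> (k + pi / x))) \<le> 4 * C / (1 + k\<^sup>2)"
    proof (intro eventually_mono[OF eventually_ge_at_top[of pi]] AE_I2)
      fix x k :: real assume x: "x \<ge> pi"
      define t where "t = pi / x"
      have "x > 0" using x pi_gt_zero by linarith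
      then have "\<bar>t\<bar> \<le> 1" using x by (simp add: t_def)
      then have t: "t\<^sup>2 \<le> 1" using abs_square_le_1 by blast
      \<comment> \<open>A shift by at most 1 costs only a factor 3 in the decay bound, the slack
        being an explicit sum of nonnegative terms. With the unshifted term this makes the majorant
        \<open>4 * C / (1 + k^2)\<close>, uniform in \<open>x \<ge> pi\<close>.\<close>
      have "1 + k\<^sup>2 \<le> 3 * (1 + (k + t)\<^sup>2)"
      proof -
        have "3 * (1 + (k + t)\<^sup>2) - (1 + k\<^sup>2) = 2 * (1 - t\<^sup>2) + (k + t)\<^sup>2 + (k + 2 * t)\<^sup>2"
          by (simp add: power2_eq_square algebra_simps)
        then show ?thesis using t by (smt (verit) zero_le_power2)
      qed
      then have "C * 3 / (3 * (1 + (k + t)\<^sup>2)) \<le> C * 3 / (1 + k\<^sup>2)"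
        using C by (intro divide_left_mono mult_pos_pos add_pos_nonneg) auto
      moreover have "C * 3 / (3 * (1 + (k + t)\<^sup>2)) = C / (1 + (k + t)\<^sup>2)"
        by (subst mult.commute[of 3], rule mult_divide_mult_cancel_right) simp
      ultimately have "C / (1 + (k + t)\<^sup>2) \<le> C * 3 / (1 + k\<^sup>2)" by (simp only:)
      then have "cmod (\<Gamma> (k + t)) \<le> C * 3 / (1 + k\<^sup>2)" using decay order_trans by blast
      moreover have "cmod (\<Gamma> k - \<Gamma> (k + t)) \<le> cmod (\<Gamma> k) + cmod (\<Gamma> (k + t))" by (rule norm_triangle_ineq4)
      ultimately have "cmod (\<Gamma> k - \<Gamma> (k + t)) \<le> C / (1 + k\<^sup>2) + C * 3 / (1 + k\<^sup>2)"
        using decay[of k] by linarith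
      then show "norm (cmod (\<Gamma> k - \<Gamma> (k + pi / x))) \<le> 4 * C / (1 + k\<^sup>2)"
        by (simp add: t_def add_divide_distrib[symmetric])
    qed
  qed auto
  then have "((\<lambda>x. (1 / sqrt (2 * pi)) / 2 * R x) \<longlongrightarrow> (1 / sqrt (2 * pi)) / 2 * 0) at_top"
    by (intro tendsto_mult tendsto_const) simp
  then show ?thesis
    by (intro Lim_null_comparison[OF eventually_mono[OF eventually_gt_at_top[of 0] le]]) simp_all
qed

section \<open>Correlators in the vacuum and in one-particle states\<close>

text \<open>One integral over the plane replaces the iterated one, since product formulas and
  dominated convergence live there; integrability lets Fubini pass between the two.\<close>

lemma is_correlatorI:
  assumes "continuous_on {p. fst p \<noteq> snd p} (\<lambda>p. w (fst p) (snd p))"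
    and "\<And>f h. test_fun f \<Longrightarrow> test_fun h \<Longrightarrow> supp f \<inter> supp h = {} \<Longrightarrow>
       integrable lborel (\<lambda>p. cnj (f (fst p)) * h (snd p) * w (fst p) (snd p)) \<and>
       fock_inner (dfield X f \<Psi>) (dfield X h \<Psi>) = (\<integral>p. cnj (f (fst p)) * h (snd p) * w (fst p) (snd p) \<partial>lborel)"
  shows "is_correlator X \<Psi> w"
  unfolding is_correlator_def
proof (intro conjI allI impI)
  have "{(y, y'). y \<noteq> (y' :: real)} = {p. fst p \<noteq> snd p}" by auto
  then show "continuous_on {(y, y'). y \<noteq> y'} (\<lambda>(y, y'). w y y')"
    using assms(1) by (simp add: case_prod_unfold)
  fix f h assume fh: "test_fun f \<and> test_fun h \<and> supp f \<inter> supp h = {}"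
  let ?F = "\<lambda>p. cnj (f (fst p)) * h (snd p) * w (fst p) (snd p)"
  have "integrable (lborel \<Otimes>\<^sub>M lborel) ?F" using assms(2)[of f h] fh by (simp add: lborel_prod)
  from lborel_pair.integral_fst'[OF this] assms(2)[of f h] fh
  show "fock_inner (dfield X f \<Psi>) (dfield X h \<Psi>) = (\<integral>y. (\<integral>y'. cnj (f y) * h y' * w y y' \<partial>lborel) \<partial>lborel)"
    by (simp add: lborel_prod)
qed

context reparametrization begin

lemma continuous_vacuum_correlation:
  "continuous_on {p. fst p \<noteq> snd p} (\<lambda>p. vacuum_correlation X X' (fst p) (snd p))"
  unfolding vacuum_correlation_def
  by (intro continuous_intros continuous_on_of_real continuous_on_compose2[OF continuous_X[of UNIV]]
      continuous_on_compose2[OF continuous_X'[of UNIV]]) (auto simp: X_eq_iff)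

lemma is_correlator_vacuum: "is_correlator X vacuum (vacuum_correlation X X')"
  by (rule is_correlatorI[OF continuous_vacuum_correlation])
     (simp add: fock_inner_dfield_vacuum integrable_mode_vderiv_product vacuum_two_point)

text \<open>Up to a constant factor and conjugation, this is the matrix element of the derivative
  field at \<open>y\<close> between the vacuum and the packet; \<open>X'\<close> is its chain-rule
  factor.\<close>

definition packet_mode :: "(real \<Rightarrow> complex) \<Rightarrow> real \<Rightarrow> complex" where
  "packet_mode g y = of_real (X' y) * fourier (fourier g) (- X y)"

text \<open>The first term of \<open>fock_inner_dfield_one_particle\<close> is the vacuum two-point
  function times the norm 1 of the packet. The other two factor into a smearing with
  \<open>f\<close> and one with \<open>h\<close>, hence the products of packet modes;
  \<open>1 / 4\<close> is the squared modulus of the constants \<open>\<i> / 2\<close>.\<close>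

lemma is_correlator_one_particle:
  assumes g: "schwartz_plus g" "normalized g"
  shows "is_correlator X (one_particle g) (\<lambda>y z. vacuum_correlation X X' y z
    + (packet_mode g y * cnj (packet_mode g z) + cnj (packet_mode g y) * packet_mode g z) / 4)"
proof (rule is_correlatorI)
  let ?G = "fourier g"
  have sg: "schwartz g" and G0: "\<And>k. k \<le> 0 \<Longrightarrow> ?G k = 0"
    using g(1) by (auto simp: schwartz_plus_def)
  obtain C where C: "\<And>k. cmod (?G k) \<le> C / (1 + k\<^sup>2)" by (rule fourier_decay[OF sg]) (rule that)
  have contG: "continuous_on UNIV ?G" by (rule continuous_fourier[OF integrable_schwartz[OF sg]])
  have intG: "integrable lborel ?G" by (rule integrable_inverse_square_decay[OF contG C])
  have [measurable]: "?G \<in> borel_measurable borel" by (rule borel_measurable_continuous_onI[OF contG])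
  obtain B where B: "\<And>k. cmod (?G k) \<le> B" by (rule fourier_bounded) (rule that)
  \<comment> \<open>Smearing with \<open>u\<close> gives the overlap of the packet with the particle
    created by the field; smearing with \<open>v\<close> gives the amplitude for annihilating the
    packet.\<close>
  define u where "u y = packet_mode g y * (- \<i> / 2)" for y
  define v where "v y = cnj (packet_mode g y) * (\<i> / 2)" for y
  have contp: "continuous_on UNIV (packet_mode g)"
    unfolding packet_mode_def
    by (intro continuous_intros continuous_on_of_real continuous_X'
        continuous_on_compose2[OF continuous_fourier[OF intG]] continuous_X) auto
  then have contuv: "continuous_on UNIV u" "continuous_on UNIV v"
    unfolding u_def v_def by (auto intro!: continuous_intros)
  have split: "(packet_mode g y * cnj (packet_mode g z) + cnj (packet_mode g y) * packet_mode g z) / 4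
     = cnj (u y) * u z + cnj (v y) * v z" for y z
    by (simp add: u_def v_def complex_eq_iff field_simps)
  show "continuous_on {p. fst p \<noteq> snd p} (\<lambda>p. vacuum_correlation X X' (fst p) (snd p)
    + (packet_mode g (fst p) * cnj (packet_mode g (snd p)) + cnj (packet_mode g (fst p)) * packet_mode g (snd p)) / 4)"
    by (intro continuous_intros continuous_vacuum_correlation continuous_on_compose2[OF contp]) auto
  have norm1: "(\<integral>k. cnj (cnj (?G k)) * cnj (?G k) \<partial>dk2k) = 1"
    and normint: "integrable dk2k (\<lambda>k. cnj (cnj (?G k)) * cnj (?G k))"
  proof -
    have 1: "(\<integral>k. (cmod (?G k))\<^sup>2 \<partial>dk2k) = 1" using g(2) by (simp add: normalized_def)
    \<comment> \<open>A non-integrable function has integral 0 by convention, so the value 1 already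
      yields integrability, including near the singularity of the weight.\<close>
    then have i: "integrable dk2k (\<lambda>k. (cmod (?G k))\<^sup>2)"
      using not_integrable_integral_eq by fastforce
    have eq: "cnj (cnj (?G k)) * cnj (?G k) = complex_of_real ((cmod (?G k))\<^sup>2)" for k
      using complex_norm_square[of "?G k"] by simp
    show "(\<integral>k. cnj (cnj (?G k)) * cnj (?G k) \<partial>dk2k) = 1"
      unfolding eq by (simp only: integral_complex_of_real 1 of_real_1)
    show "integrable dk2k (\<lambda>k. cnj (cnj (?G k)) * cnj (?G k))"
      unfolding eq using i by (rule integrable_of_real)
  qed
  have overlap1: "(\<integral>k. mode X (vderiv h) k * cnj (?G k) \<partial>dk2k) = (\<integral>y. h y * v y \<partial>lborel)" if h: "test_fun h" for h
  proof -
    have "(\<integral>k. mode X (vderiv h) (1 * k) * cnj (?G k) \<partial>dk2k)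
        = (\<integral>y. h y * (\<i> * of_real (1 / 2) * of_real (X' y) * fourier (\<lambda>k. cnj (?G k)) (1 * X y)) \<partial>lborel)"
      by (rule mode_vderiv_overlap[OF h]) (use intG G0 in auto)
    moreover have "fourier (\<lambda>k. cnj (?G k)) x = cnj (fourier ?G (- x))" for x
      using mode_cnj[of "\<lambda>x. x" ?G x] by (simp add: mode_id)
    ultimately show ?thesis by (simp add: v_def packet_mode_def mult_ac)
  qed
  have overlap2: "(\<integral>k. ?G k * mode X (vderiv h) (- k) \<partial>dk2k) = (\<integral>y. h y * u y \<partial>lborel)" if h: "test_fun h" for h
  proof -
    have "(\<integral>k. mode X (vderiv h) (- 1 * k) * ?G k \<partial>dk2k)
        = (\<integral>y. h y * (\<i> * of_real (- 1 / 2) * of_real (X' y) * fourier ?G (- 1 * X y)) \<partial>lborel)"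
      by (rule mode_vderiv_overlap[OF h]) (use intG G0 in auto)
    then show ?thesis by (simp add: u_def packet_mode_def mult_ac)
  qed
  fix f h assume f: "test_fun f" and h: "test_fun h" and disj: "supp f \<inter> supp h = {}"
  let ?F = "\<lambda>p. cnj (f (fst p)) * h (snd p) * vacuum_correlation X X' (fst p) (snd p)"
  have int1: "integrable lborel (\<lambda>y. t y * c y)" if "test_fun t" "continuous_on UNIV c" for t c :: "real \<Rightarrow> complex"
    by (rule integrable_compact_support[OF test_fun_compact[OF that(1)]])
       (auto simp: test_fun_zero[of _ t] intro!: continuous_intros smooth_continuous_on[OF test_fun_smooth[OF that(1)]]
          continuous_on_subset[OF that(2)])
  note fu = int1[OF f contuv(1)] and fv = int1[OF f contuv(2)] and hu = int1[OF h contuv(1)] and hv = int1[OF h contuv(2)]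
  note pu = integral_lborel_pair_mult[OF integrable_cnj[OF fu] hu] and pv = integral_lborel_pair_mult[OF integrable_cnj[OF fv] hv]
  note vac = vacuum_two_point[OF f h disj]
  have eq: "cnj (f y) * h z * (vacuum_correlation X X' y z
    + (packet_mode g y * cnj (packet_mode g z) + cnj (packet_mode g y) * packet_mode g z) / 4)
    = cnj (f y) * h z * vacuum_correlation X X' y z + cnj (f y * u y) * (h z * u z) + cnj (f y * v y) * (h z * v z)" for y z
    unfolding split by (simp add: algebra_simps)
  have iBG: "integrable dk2k (\<lambda>k. cnj (mode X (vderiv f) (- k)) * cnj (?G k))"
    using integrable_mode_vderiv_mult(2)[OF f, of "-1" "\<lambda>k. cnj (?G k)" B] B by simp
  have iGB: "integrable dk2k (\<lambda>k. cnj (cnj (?G k)) * mode X (vderiv h) (- k))"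
    using integrable_mode_vderiv_mult(1)[OF h, of "-1" ?G B] B by (simp add: mult.commute)
  have BG: "(\<integral>k. cnj (mode X (vderiv f) (- k)) * cnj (?G k) \<partial>dk2k) = cnj (\<integral>y. f y * u y \<partial>lborel)"
    unfolding overlap2[OF f, symmetric] Bochner_Integration.integral_cnj[symmetric] by (simp add: mult.commute)
  have GB: "(\<integral>k. cnj (cnj (?G k)) * mode X (vderiv h) (- k) \<partial>dk2k) = (\<integral>y. h y * u y \<partial>lborel)"
    using overlap2[OF h] by simp
  have "fock_inner (dfield X f (one_particle g)) (dfield X h (one_particle g))
     = integral\<^sup>L lborel ?F + cnj (\<integral>y. f y * u y \<partial>lborel) * (\<integral>y. h y * u y \<partial>lborel)
       + cnj (\<integral>y. f y * v y \<partial>lborel) * (\<integral>y. h y * v y \<partial>lborel)"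
    unfolding fock_inner_dfield_one_particle[OF integrable_mode_vderiv_product[OF f h] normint iBG iGB]
    unfolding norm1 BG GB overlap1[OF f] overlap1[OF h] vac(2) by simp
  also have "\<dots> = (\<integral>p. ?F p + cnj (f (fst p) * u (fst p)) * (h (snd p) * u (snd p))
       + cnj (f (fst p) * v (fst p)) * (h (snd p) * v (snd p)) \<partial>lborel)"
    using vac(1) pu pv by (simp del: complex_cnj_mult)
  finally show "integrable lborel (\<lambda>p. cnj (f (fst p)) * h (snd p) * (vacuum_correlation X X' (fst p) (snd p)
      + (packet_mode g (fst p) * cnj (packet_mode g (snd p)) + cnj (packet_mode g (fst p)) * packet_mode g (snd p)) / 4)) \<and>
    fock_inner (dfield X f (one_particle g)) (dfield X h (one_particle g)) =
      (\<integral>p. cnj (f (fst p)) * h (snd p) * (vacuum_correlation X X' (fst p) (snd p)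
      + (packet_mode g (fst p) * cnj (packet_mode g (snd p)) + cnj (packet_mode g (fst p)) * packet_mode g (snd p)) / 4) \<partial>lborel)"
    unfolding eq using vac(1) pu(1) pv(1) by (auto intro!: Bochner_Integration.integrable_add)
qed

end

section \<open>Coincidence limits\<close>

text \<open>The incoming field itself, whose vacuum correlator is the term subtracted in
  \<open>emt_out\<close>, at separation \<open>\<epsilon>\<close> in the incoming
  coordinate.\<close>

interpretation incoming: reparametrization "\<lambda>x. x" "\<lambda>_. 1" "\<lambda>_. 0"
  by unfold_locales (auto intro!: derivative_eq_intros)

context reparametrization begin

text \<open>\<open>s\<close> is minus one sixth of the Schwarzian derivative of \<open>X\<close> at \<open>y\<close>.\<close>

lemma emt_out_eq:
  assumes g: "schwartz_plus g" "normalized g"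
    and lim: "((\<lambda>\<epsilon>. 1 / \<epsilon>\<^sup>2 - X' y * X' (y + \<epsilon>) / (X y - X (y + \<epsilon>))\<^sup>2) \<longlongrightarrow> s) (at 0)"
  shows "emt_out X g y = of_real (s / (4 * pi) + (X' y)\<^sup>2 * (cmod (fourier (fourier g) (- X y)))\<^sup>2 / 2)"
proof -
  let ?p = "packet_mode g"
  have sg: "schwartz g" using g(1) by (simp add: schwartz_plus_def)
  obtain C where C: "\<And>k. cmod (fourier g k) \<le> C / (1 + k\<^sup>2)" by (rule fourier_decay[OF sg]) (rule that)
  have contG: "continuous_on UNIV (fourier g)" by (rule continuous_fourier[OF integrable_schwartz[OF sg]])
  have contp: "continuous_on UNIV ?p"
    unfolding packet_mode_def
    by (intro continuous_intros continuous_on_of_real continuous_X' continuous_X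
        continuous_on_compose2[OF continuous_fourier[OF integrable_inverse_square_decay[OF contG C]]]) auto
  \<comment> \<open>Restricted to \<open>\<epsilon> \<noteq> 0\<close>, because the correlator is
    determined only off the diagonal; the limit at 0 asks for no more.\<close>
  have eq: "theta_mean X (one_particle g) \<epsilon> y - theta_mean (\<lambda>x. x) vacuum \<epsilon> (X y)
     = of_real ((1 / \<epsilon>\<^sup>2 - X' y * X' (y + \<epsilon>) / (X y - X (y + \<epsilon>))\<^sup>2) / (4 * pi))
       + (?p y * cnj (?p (y + \<epsilon>)) + cnj (?p y) * ?p (y + \<epsilon>)) / 4" if "\<epsilon> \<noteq> 0" for \<epsilon>
  proof -
    have sym: "vacuum_correlation X X' (y + \<epsilon>) y = vacuum_correlation X X' y (y + \<epsilon>)"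
      unfolding vacuum_correlation_def by (simp only: power2_commute[of "X (y + \<epsilon>)"] mult.commute[of "X' (y + \<epsilon>)"])
    have "theta_mean X (one_particle g) \<epsilon> y = vacuum_correlation X X' y (y + \<epsilon>)
       + (?p y * cnj (?p (y + \<epsilon>)) + cnj (?p y) * ?p (y + \<epsilon>)) / 4"
      using that
      by (simp add: theta_mean_def correlator_eq[OF is_correlator_one_particle[OF g]] sym) (simp add: field_simps)
    moreover have "theta_mean (\<lambda>x. x) vacuum \<epsilon> (X y) = of_real (- 1 / (4 * pi * \<epsilon>\<^sup>2))"
      using that by (simp add: theta_mean_def correlator_eq[OF incoming.is_correlator_vacuum] vacuum_correlation_def)
    moreover have "vacuum_correlation X X' y (y + \<epsilon>) - of_real (- 1 / (4 * pi * \<epsilon>\<^sup>2))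
       = of_real ((1 / \<epsilon>\<^sup>2 - X' y * X' (y + \<epsilon>) / (X y - X (y + \<epsilon>))\<^sup>2) / (4 * pi))"
      unfolding vacuum_correlation_def of_real_diff[symmetric]
      by (rule arg_cong[where f = of_real]) (simp add: diff_divide_distrib mult_ac)
    ultimately show ?thesis by (simp add: algebra_simps)
  qed
  \<comment> \<open>The packet part is continuous up to the diagonal, so only the difference of
    vacuum parts needs a limit hypothesis.\<close>
  have "((\<lambda>\<epsilon>. ?p (y + \<epsilon>)) \<longlongrightarrow> ?p y) (at 0)"
    using contp by (simp add: continuous_on_eq_continuous_at isCont_def LIM_offset_zero_iff)
  then have "((\<lambda>\<epsilon>. of_real ((1 / \<epsilon>\<^sup>2 - X' y * X' (y + \<epsilon>) / (X y - X (y + \<epsilon>))\<^sup>2) / (4 * pi))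
       + (?p y * cnj (?p (y + \<epsilon>)) + cnj (?p y) * ?p (y + \<epsilon>)) / 4)
      \<longlongrightarrow> of_real (s / (4 * pi)) + (?p y * cnj (?p y) + cnj (?p y) * ?p y) / 4) (at 0)"
    by (intro tendsto_intros lim) auto
  moreover have "\<forall>\<^sub>F \<epsilon> in at 0. theta_mean X (one_particle g) \<epsilon> y - theta_mean (\<lambda>x. x) vacuum \<epsilon> (X y)
     = of_real ((1 / \<epsilon>\<^sup>2 - X' y * X' (y + \<epsilon>) / (X y - X (y + \<epsilon>))\<^sup>2) / (4 * pi))
       + (?p y * cnj (?p (y + \<epsilon>)) + cnj (?p y) * ?p (y + \<epsilon>)) / 4"
    by (rule eventually_mono[OF eventually_neq_at_within eq])
  ultimately have "((\<lambda>\<epsilon>. theta_mean X (one_particle g) \<epsilon> y - theta_mean (\<lambda>x. x) vacuum \<epsilon> (X y))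
      \<longlongrightarrow> of_real (s / (4 * pi)) + (?p y * cnj (?p y) + cnj (?p y) * ?p y) / 4) (at 0)"
    by (simp add: tendsto_cong)
  then have "emt_out X g y = of_real (s / (4 * pi)) + (?p y * cnj (?p y) + cnj (?p y) * ?p y) / 4"
    unfolding emt_out_def by (intro tendsto_Lim) auto
  also have "(?p y * cnj (?p y) + cnj (?p y) * ?p y) / 4 = of_real ((cmod (?p y))\<^sup>2 / 2)"
    using complex_norm_square[of "?p y"] by simp
  also have "(cmod (?p y))\<^sup>2 = (X' y)\<^sup>2 * (cmod (fourier (fourier g) (- X y)))\<^sup>2"
    by (simp add: packet_mode_def norm_mult power_mult_distrib)
  finally show ?thesis by (simp add: add_divide_distrib)
qed

text \<open>The packet enters only through the product of \<open>X'\<close> with the doubly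
  transformed \<open>g\<close>, so decay of either factor suffices as long as the other stays
  bounded.\<close>

lemma emt_out_tendsto:
  assumes g: "schwartz_plus g" "normalized g"
    and lim: "\<And>y. ((\<lambda>\<epsilon>. 1 / \<epsilon>\<^sup>2 - X' y * X' (y + \<epsilon>) / (X y - X (y + \<epsilon>))\<^sup>2) \<longlongrightarrow> s y) (at 0)"
    and s: "(s \<longlongrightarrow> s0) F"
    and p: "((\<lambda>y. X' y * cmod (fourier (fourier g) (- X y))) \<longlongrightarrow> 0) F"
  shows "(emt_out X g \<longlongrightarrow> of_real (s0 / (4 * pi))) F"
proof -
  have eq: "emt_out X g = (\<lambda>y. of_real (s y / (4 * pi) + (X' y * cmod (fourier (fourier g) (- X y)))\<^sup>2 / 2))"
    using emt_out_eq[OF g lim] by (auto simp: power_mult_distrib)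
  have "((\<lambda>y. s y / (4 * pi) + (X' y * cmod (fourier (fourier g) (- X y)))\<^sup>2 / 2) \<longlongrightarrow> s0 / (4 * pi) + 0\<^sup>2 / 2) F"
    by (intro tendsto_intros s p) auto
  then show ?thesis unfolding eq by (intro tendsto_of_real) simp
qed

end

lemma bounded_times_tendsto_0:
  fixes u :: "real \<Rightarrow> real" and G :: "real \<Rightarrow> complex"
  assumes "(u \<longlongrightarrow> 0) F" "\<And>x. cmod (G x) \<le> B"
  shows "((\<lambda>y. u y * cmod (G y)) \<longlongrightarrow> 0) F"
proof (rule tendsto_0_le[OF assms(1), where K = B])
  show "\<forall>\<^sub>F y in F. norm (u y * cmod (G y)) \<le> norm (u y) * B"
    by (intro always_eventually allI) (simp add: abs_mult assms(2) mult_left_mono)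
qed

section \<open>The relativistic and the CGHS coordinate maps\<close>

interpretation rel: reparametrization x_rel "\<lambda>y. exp (- y)" "\<lambda>y. - exp (- y)"
  by unfold_locales (auto simp: x_rel_def[abs_def] intro!: derivative_eq_intros continuous_intros)

definition x_CGHS' :: "real \<Rightarrow> real" where
  "x_CGHS' y = exp (- y) / (1 + exp (- y))"

lemma one_plus_exp_pos: "1 + exp (- y) > (0::real)"
  by (simp add: add_pos_pos)

interpretation CGHS: reparametrization x_CGHS x_CGHS' "\<lambda>y. - exp (- y) / (1 + exp (- y))\<^sup>2"
proof unfold_locales
  fix y :: real
  have nz: "1 + exp (- y) \<noteq> 0" for y :: real using one_plus_exp_pos[of y] by simp
  show "(x_CGHS has_real_derivative x_CGHS' y) (at y)"
    unfolding x_CGHS_def[abs_def] x_CGHS'_def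
    by (auto intro!: derivative_eq_intros simp: one_plus_exp_pos divide_inverse)
  show "(x_CGHS' has_real_derivative - exp (- y) / (1 + exp (- y))\<^sup>2) (at y)"
    unfolding x_CGHS'_def[abs_def]
    by (rule derivative_eq_intros refl nz | simp add: power2_eq_square algebra_simps)+
  show "continuous_on UNIV (\<lambda>y::real. - exp (- y) / (1 + exp (- y))\<^sup>2)"
    by (intro continuous_intros) (simp add: nz)
  show "x_CGHS' y > 0" by (simp add: x_CGHS'_def one_plus_exp_pos)
qed

text \<open>The subtracted quotient is \<open>1 / (4 * sinh (\<epsilon> / 2)^2)\<close>, and
  \<open>1 / 12\<close> is minus the constant term of its Laurent expansion.\<close>

lemma schwarzian_limit_exp:
  "((\<lambda>\<epsilon>. 1 / \<epsilon>\<^sup>2 - exp (- \<epsilon>) / (exp (- \<epsilon>) - 1)\<^sup>2) \<longlongrightarrow> 1 / 12) (at (0::real))"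
  by real_asymp

text \<open>Under the exponential map a shift of \<open>y\<close> is a rescaling of
  \<open>x\<close>, so \<open>exp (- y)\<close> cancels: the vacuum contribution has its thermal
  value at every \<open>y\<close>.\<close>

lemma schwarzian_limit_rel:
  "((\<lambda>\<epsilon>. 1 / \<epsilon>\<^sup>2 - exp (- y) * exp (- (y + \<epsilon>)) / (x_rel y - x_rel (y + \<epsilon>))\<^sup>2) \<longlongrightarrow> 1 / 12) (at 0)"
proof -
  have "exp (- y) * exp (- (y + \<epsilon>)) / (x_rel y - x_rel (y + \<epsilon>))\<^sup>2 = exp (- \<epsilon>) / (exp (- \<epsilon>) - 1)\<^sup>2" for \<epsilon>
  proof -
    have "x_rel y - x_rel (y + \<epsilon>) = exp (- y) * (exp (- \<epsilon>) - 1)"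
      by (simp add: x_rel_def exp_add[symmetric] algebra_simps)
    then show ?thesis
      by (simp add: exp_add[of "- y" "- \<epsilon>", simplified] power_mult_distrib power2_eq_square)
  qed
  then show ?thesis using schwarzian_limit_exp by (simp only:)
qed

text \<open>Cocycle property of the Schwarzian: reparametrizing by \<open>v\<close>, where
  \<open>exp (- v) = 1 - c * (1 - exp (- \<epsilon>))\<close>, reduces the limit to two exponential ones.\<close>

lemma schwarzian_limit_log:
  assumes c: "0 < c" "c < 1"
  shows "((\<lambda>\<epsilon>. 1 / \<epsilon>\<^sup>2 - c\<^sup>2 * exp (- \<epsilon>) / ((1 - c * (1 - exp (- \<epsilon>))) * (ln (1 - c * (1 - exp (- \<epsilon>))))\<^sup>2))
    \<longlongrightarrow> (1 - c\<^sup>2) / 12) (at (0::real))"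
proof -
  define \<psi> :: "real \<Rightarrow> real" where "\<psi> t = 1 / t\<^sup>2 - exp (- t) / (exp (- t) - 1)\<^sup>2" for t
  define q where "q \<epsilon> = 1 - c * (1 - exp (- \<epsilon>))" for \<epsilon> :: real
  define v where "v \<epsilon> = - ln (q \<epsilon>)" for \<epsilon>
  have q: "q \<epsilon> > 0" for \<epsilon>
  proof -
    have "q \<epsilon> = (1 - c) + c * exp (- \<epsilon>)" by (simp add: q_def algebra_simps)
    then show ?thesis using c by (simp add: add_pos_pos)
  qed
  have qlim: "(q \<longlongrightarrow> 1) (at 0)"
    unfolding q_def by (auto intro!: tendsto_eq_intros)
  have v0: "v \<epsilon> \<noteq> 0" if "\<epsilon> \<noteq> 0" for \<epsilon>
  proof -
    have "q \<epsilon> \<noteq> 1" using that c(1) by (simp add: q_def)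
    then show ?thesis unfolding v_def neg_equal_0_iff_equal ln_eq_zero_iff[OF q] .
  qed
  have "(v \<longlongrightarrow> - ln 1) (at 0)"
    unfolding v_def by (intro tendsto_intros qlim) auto
  \<comment> \<open>The limit of \<open>\<psi>\<close> is taken over punctured neighbourhoods, so
    \<open>v\<close> has to avoid 0 as well as tend to it.\<close>
  then have "filterlim v (at 0) (at 0)"
    by (intro filterlim_atI eventually_mono[OF eventually_neq_at_within v0]) simp_all
  moreover have \<psi>: "(\<psi> \<longlongrightarrow> 1 / 12) (at 0)"
    unfolding \<psi>_def by (rule schwarzian_limit_exp)
  ultimately have "((\<lambda>\<epsilon>. \<psi> (v \<epsilon>)) \<longlongrightarrow> 1 / 12) (at 0)"
    by (rule filterlim_compose[rotated])
  \<comment> \<open>The coefficient \<open>c^2 * exp (- \<epsilon>) / q \<epsilon>\<close> is the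
    product of the derivatives of \<open>v\<close> at 0 and at \<open>\<epsilon>\<close>. With it
    the exponential terms of \<open>\<psi> \<epsilon>\<close> and
    \<open>\<psi> (v \<epsilon>)\<close> cancel, because
    \<open>exp (- v \<epsilon>) = q \<epsilon>\<close>, and the target expression remains.\<close>
  then have "((\<lambda>\<epsilon>. \<psi> \<epsilon> - c\<^sup>2 * exp (- \<epsilon>) / q \<epsilon> * \<psi> (v \<epsilon>)) \<longlongrightarrow> 1 / 12 - c\<^sup>2 * exp (- 0) / 1 * (1 / 12)) (at 0)"
    by (intro tendsto_intros \<psi> qlim) auto
  moreover have "\<forall>\<^sub>F \<epsilon> in at 0. \<psi> \<epsilon> - c\<^sup>2 * exp (- \<epsilon>) / q \<epsilon> * \<psi> (v \<epsilon>)
     = 1 / \<epsilon>\<^sup>2 - c\<^sup>2 * exp (- \<epsilon>) / (q \<epsilon> * (ln (q \<epsilon>))\<^sup>2)"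
  proof -
    have "\<psi> \<epsilon> - c\<^sup>2 * exp (- \<epsilon>) / q \<epsilon> * \<psi> (v \<epsilon>) = 1 / \<epsilon>\<^sup>2 - c\<^sup>2 * exp (- \<epsilon>) / (q \<epsilon> * (ln (q \<epsilon>))\<^sup>2)"
      if "\<epsilon> \<noteq> 0" for \<epsilon>
    proof -
      let ?e = "exp (- \<epsilon>)"
      have e: "?e - 1 \<noteq> 0" using that by simp
      have "exp (- v \<epsilon>) = q \<epsilon>" using q[of \<epsilon>] by (simp add: v_def)
      moreover have "q \<epsilon> - 1 = c * (?e - 1)" by (simp add: q_def algebra_simps)
      ultimately have "\<psi> (v \<epsilon>) = 1 / (ln (q \<epsilon>))\<^sup>2 - q \<epsilon> / (c\<^sup>2 * (?e - 1)\<^sup>2)"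
        by (simp add: \<psi>_def power_mult_distrib) (simp add: v_def)
      then have "c\<^sup>2 * ?e / q \<epsilon> * \<psi> (v \<epsilon>)
          = c\<^sup>2 * ?e / (q \<epsilon> * (ln (q \<epsilon>))\<^sup>2) - (c\<^sup>2 * ?e / q \<epsilon>) * (q \<epsilon> / (c\<^sup>2 * (?e - 1)\<^sup>2))"
        by (simp only: right_diff_distrib times_divide_times_eq mult_1_right)
      also have "(c\<^sup>2 * ?e / q \<epsilon>) * (q \<epsilon> / (c\<^sup>2 * (?e - 1)\<^sup>2)) = ?e / (?e - 1)\<^sup>2"
        using q[of \<epsilon>] c by simp
      finally show ?thesis by (simp add: \<psi>_def)
    qed
    then show ?thesis by (rule eventually_mono[OF eventually_neq_at_within])
  qed
  ultimately have "((\<lambda>\<epsilon>. 1 / \<epsilon>\<^sup>2 - c\<^sup>2 * exp (- \<epsilon>) / (q \<epsilon> * (ln (q \<epsilon>))\<^sup>2)) \<longlongrightarrow> 1 / 12 - c\<^sup>2 * exp (- 0) / 1 * (1 / 12)) (at 0)"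
    by (rule Lim_transform_eventually)
  then show ?thesis by (simp add: q_def diff_divide_distrib)
qed

text \<open>With \<open>c = x_CGHS' y\<close>, the expression
  \<open>1 - c * (1 - exp (- \<epsilon>))\<close> is the ratio of
  \<open>1 + exp (- (y + \<epsilon>))\<close> to \<open>1 + exp (- y)\<close>, and its logarithm is
  the difference of the two values of \<open>x_CGHS\<close>. As \<open>c\<close> runs from 1 at
  minus infinity to 0 at plus infinity, the limit interpolates between no radiation and the thermal
  value.\<close>

lemma schwarzian_limit_CGHS:
  "((\<lambda>\<epsilon>. 1 / \<epsilon>\<^sup>2 - x_CGHS' y * x_CGHS' (y + \<epsilon>) / (x_CGHS y - x_CGHS (y + \<epsilon>))\<^sup>2)
    \<longlongrightarrow> (1 - (x_CGHS' y)\<^sup>2) / 12) (at 0)"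
proof -
  have c: "0 < x_CGHS' y" "x_CGHS' y < 1"
    using CGHS.X'_pos by (simp_all add: x_CGHS'_def one_plus_exp_pos)
  have "x_CGHS' y * x_CGHS' (y + \<epsilon>) / (x_CGHS y - x_CGHS (y + \<epsilon>))\<^sup>2
    = (x_CGHS' y)\<^sup>2 * exp (- \<epsilon>) / ((1 - x_CGHS' y * (1 - exp (- \<epsilon>))) * (ln (1 - x_CGHS' y * (1 - exp (- \<epsilon>))))\<^sup>2)" for \<epsilon>
  proof -
    define r where "r = 1 - x_CGHS' y * (1 - exp (- \<epsilon>))"
    have nz: "1 + exp (- y) \<noteq> 0" "1 + exp (- (y + \<epsilon>)) \<noteq> 0"
      using one_plus_exp_pos[of y] one_plus_exp_pos[of "y + \<epsilon>"] by simp_all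
    have e: "exp (- (y + \<epsilon>)) = exp (- y) * exp (- \<epsilon>)" by (simp add: exp_add[symmetric])
    have r: "r = (1 + exp (- (y + \<epsilon>))) / (1 + exp (- y))"
      using nz(1) unfolding r_def x_CGHS'_def e by (simp add: field_simps)
    have "ln r = x_CGHS y - x_CGHS (y + \<epsilon>)"
      unfolding r x_CGHS_def by (subst ln_divide_pos) (simp_all only: one_plus_exp_pos)
    moreover have "x_CGHS' (y + \<epsilon>) = x_CGHS' y * exp (- \<epsilon>) / r"
    proof -
      have "a * b / E = a / A * b / (E / A)" if "A \<noteq> 0" for a b A E :: real using that by simp
      from this[OF nz(1)] show ?thesis unfolding r x_CGHS'_def e .
    qed
    ultimately show ?thesis unfolding r_def[symmetric] by (simp add: power2_eq_square)
  qed
  then show ?thesis using schwarzian_limit_log[OF c] by (simp only:)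
qed

section \<open>Asymptotic values of the outgoing energy-momentum tensor\<close>

theorem theorem6:
  fixes g :: "real \<Rightarrow> complex"
  assumes "schwartz_plus g" and "normalized g"
  shows "(emt_out x_rel g \<longlongrightarrow> complex_of_real (emt_thermal (ereal (2 * pi)))) at_top
       \<and> (emt_out x_CGHS g \<longlongrightarrow> complex_of_real (emt_thermal (ereal (2 * pi)))) at_top
       \<and> (emt_out x_CGHS g \<longlongrightarrow> complex_of_real (emt_thermal \<infinity>)) at_bot
       \<and> emt_thermal (ereal (2 * pi)) = 1 / (48 * pi)
       \<and> emt_thermal \<infinity> = 0"
proof -
  have th: "emt_thermal (ereal (2 * pi)) = 1 / (48 * pi)"
    by (simp add: emt_thermal_def power2_eq_square)
  have th_inf: "emt_thermal \<infinity> = 0"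
    by (simp add: emt_thermal_def power2_eq_square)
  obtain B where B: "\<And>x. cmod (fourier (fourier g) x) \<le> B" by (rule fourier_bounded) (rule that)
  have sg: "schwartz g" using assms(1) by (simp add: schwartz_plus_def)
  obtain C where C: "\<And>k. cmod (fourier g k) \<le> C / (1 + k\<^sup>2)" by (rule fourier_decay[OF sg]) (rule that)
  have ffg: "(fourier (fourier g) \<longlongrightarrow> 0) at_top"
    by (rule fourier_tendsto_0[OF continuous_fourier[OF integrable_schwartz[OF sg]] C])
  have l1: "((\<lambda>y::real. exp (- y)) \<longlongrightarrow> 0) at_top" by real_asymp
  have l2: "(x_CGHS' \<longlongrightarrow> 0) at_top" and l3: "(x_CGHS' \<longlongrightarrow> 1) at_bot"
    unfolding x_CGHS'_def by real_asymp+
  \<comment> \<open>\<open>- x_CGHS y\<close> grows like \<open>- y\<close> as \<open>y\<close>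
    tends to minus infinity, so Riemann-Lebesgue is needed only at plus infinity.\<close>
  have l4: "filterlim (\<lambda>y. - x_CGHS y) at_top at_bot"
    unfolding x_CGHS_def by real_asymp
  have "(emt_out x_rel g \<longlongrightarrow> of_real ((1 / 12) / (4 * pi))) at_top"
    by (rule rel.emt_out_tendsto[OF assms schwarzian_limit_rel tendsto_const])
       (rule bounded_times_tendsto_0[OF l1 B])
  moreover have "(emt_out x_CGHS g \<longlongrightarrow> of_real (((1 - 0\<^sup>2) / 12) / (4 * pi))) at_top"
    by (rule CGHS.emt_out_tendsto[OF assms schwarzian_limit_CGHS])
       (intro tendsto_intros l2, simp, rule bounded_times_tendsto_0[OF l2 B])
  moreover have "(emt_out x_CGHS g \<longlongrightarrow> of_real (((1 - 1\<^sup>2) / 12) / (4 * pi))) at_bot"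
  proof (rule CGHS.emt_out_tendsto[OF assms schwarzian_limit_CGHS])
    show "((\<lambda>y. (1 - (x_CGHS' y)\<^sup>2) / 12) \<longlongrightarrow> (1 - 1\<^sup>2) / 12) at_bot"
      by (intro tendsto_intros l3) simp
    have "((\<lambda>y. x_CGHS' y * cmod (fourier (fourier g) (- x_CGHS y))) \<longlongrightarrow> 1 * cmod 0) at_bot"
      by (intro tendsto_mult l3 tendsto_norm filterlim_compose[OF ffg l4])
    then show "((\<lambda>y. x_CGHS' y * cmod (fourier (fourier g) (- x_CGHS y))) \<longlongrightarrow> 0) at_bot"
      by simp
  qed
  ultimately show ?thesis using th th_inf by simp
qed

end
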